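(* Let $\Omega\subset\mathbb{R}^d$ ($d=2,3$) be a bounded regular domain, $\nu>0$, $k>0$ a constant time-step, $\varepsilon_n>0$ arbitrary positive artificial compression parameters, and $f_n\in H^{-1}(\Omega)^d$ given forcing terms. Suppose $u_n, u^1_{n}\in H^1_0(\Omega)^d$ and $p_n\in L^2(\Omega)$ satisfy, for each $n\ge1$, with $u^{\ast}=u^\ast_n=2u_n-u_{n-1}$, the (variational form of the) second-order GA-method: $$\frac{u_{n+1}^{1}-u_{n}}{k}+u^{\ast}\cdot\nabla u_{n+1}^{1}+\tfrac{1}{2}(\nabla\cdot u^{\ast})u_{n+1}^{1}+\nabla p_{n+1}-\nu\Delta u_{n+1}^{1}=f_{n+1},$$ $$u_{n+1}=u_{n+1}^{1}-\tfrac{1}{3}\left\{u_{n+1}^{1}-2u_{n}+u_{n-1}\right\},$$ $$\frac{\varepsilon_{n+1}p_{n+1}-\sqrt{\varepsilon_{n+1}\varepsilon_{n}}\,p_{n}}{k}+\nabla\cdot u_{n+1}^{1}=0.$$ Then for any $N>1$ the discrete energy equality \begin{gather*} \left[\frac{1}{4}\int_{\Omega}|u_{N+1}|^{2}+|2u_{N+1}-u_{N}|^{2}+|u_{N+1}-u_{N}|^{2}+2\varepsilon_{N+1}|p_{N+1}|^{2}\,dx\right]\\ +\sum_{n=1}^{N}\int_{\Omega}\frac{3}{4}|u_{n+1}-2u_{n}+u_{n-1}|^{2}+\frac{1}{2}|\sqrt{\varepsilon_{n+1}}p_{n+1}-\sqrt{\varepsilon_{n}}p_{n}|^{2}\,dx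 +\sum_{n=1}^{N}k\int_{\Omega}\nu\left|\nabla\left[\tfrac{3}{2}u_{n+1}-u_{n}+\tfrac{1}{2}u_{n-1}\right]\right|^{2}dx\\ =\left[\frac{1}{4}\int_{\Omega}|u_{1}|^{2}+|2u_{1}-u_{0}|^{2}+|u_{1}-u_{0}|^{2}+2\varepsilon_{1}|p_{1}|^{2}\,dx\right] +k\sum_{n=1}^{N}\int_{\Omega}f_{n+1}\cdot\left(\tfrac{3}{2}u_{n+1}-u_{n}+\tfrac{1}{2}u_{n-1}\right)dx \end{gather*} holds.
   Context: The nonlinear term is in the skew-symmetrized form $u^{\ast}\cdot\nabla w+\frac12(\nabla\cdot u^{\ast})w$. The time-step $k$ is constant while $\varepsilon_n$ may vary arbitrarily (positive). Velocities vanish on $\partial\Omega$. *)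

theory Defs
  imports "HOL-Analysis.Analysis"
begin

definition partial :: "'d::finite \<Rightarrow> (real^'d \<Rightarrow> 'b::real_normed_vector) \<Rightarrow> real^'d \<Rightarrow> 'b" where
  "partial j f x = frechet_derivative f (at x) (axis j 1)"

fun iter_partial :: "'d::finite list \<Rightarrow> (real^'d \<Rightarrow> 'b::real_normed_vector) \<Rightarrow> real^'d \<Rightarrow> 'b" where
  "iter_partial [] f = f"
| "iter_partial (j # js) f = partial j (iter_partial js f)"

definition smooth_fun :: "(real^'d::finite \<Rightarrow> 'b::real_normed_vector) \<Rightarrow> bool" where
  "smooth_fun f \<longleftrightarrow> (\<forall>js x. iter_partial js f differentiable (at x))"

definition test_fun :: "(real^'d::finite) set \<Rightarrow> (real^'d \<Rightarrow> 'b::real_normed_vector) \<Rightarrow> bool" where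
  "test_fun \<Omega> \<phi> \<longleftrightarrow> smooth_fun \<phi> \<and> compact (closure {x. \<phi> x \<noteq> 0})
      \<and> closure {x. \<phi> x \<noteq> 0} \<subseteq> \<Omega>"

definition L2 :: "(real^'d::finite) set \<Rightarrow> (real^'d \<Rightarrow> 'b::euclidean_space) set" where
  "L2 \<Omega> = {g. g \<in> borel_measurable (lebesgue_on \<Omega>)
               \<and> integrable (lebesgue_on \<Omega>) (\<lambda>x. (norm (g x))\<^sup>2)}"

text \<open>G is a weak gradient of u on Omega: G x \$ i \$ j plays the role of d_j u_i.\<close>
definition weak_grad :: "(real^'d::finite) set \<Rightarrow> (real^'d \<Rightarrow> real^'d) \<Rightarrow> (real^'d \<Rightarrow> real^'d^'d) \<Rightarrow> bool" where
  "weak_grad \<Omega> u G \<longleftrightarrow>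
     (\<forall>\<phi>::real^'d \<Rightarrow> real. test_fun \<Omega> \<phi> \<longrightarrow> (\<forall>i j.
        integral\<^sup>L (lebesgue_on \<Omega>) (\<lambda>x. u x $ i * partial j \<phi> x)
        = - integral\<^sup>L (lebesgue_on \<Omega>) (\<lambda>x. G x $ i $ j * \<phi> x)))"

definition cgrad :: "(real^'d::finite \<Rightarrow> real^'d) \<Rightarrow> real^'d \<Rightarrow> real^'d^'d" where
  "cgrad \<phi> x = (\<chi> i j. partial j \<phi> x $ i)"

definition H10 :: "(real^'d::finite) set \<Rightarrow> (real^'d \<Rightarrow> real^'d) set" where
  "H10 \<Omega> = {u. u \<in> L2 \<Omega> \<and> (\<exists>G. G \<in> L2 \<Omega> \<and> weak_grad \<Omega> u G \<and>
       (\<exists>\<phi>::nat \<Rightarrow> real^'d \<Rightarrow> real^'d. (\<forall>m. test_fun \<Omega> (\<phi> m))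
          \<and> (\<lambda>m. integral\<^sup>L (lebesgue_on \<Omega>) (\<lambda>x. (norm (\<phi> m x - u x))\<^sup>2)) \<longlonglongrightarrow> 0
          \<and> (\<lambda>m. integral\<^sup>L (lebesgue_on \<Omega>) (\<lambda>x. (norm (cgrad (\<phi> m) x - G x))\<^sup>2)) \<longlonglongrightarrow> 0))}"

text \<open>The (a.e. unique) weak gradient and weak divergence.\<close>
definition wgrad :: "(real^'d::finite) set \<Rightarrow> (real^'d \<Rightarrow> real^'d) \<Rightarrow> real^'d \<Rightarrow> real^'d^'d" where
  "wgrad \<Omega> u = (SOME G. G \<in> L2 \<Omega> \<and> weak_grad \<Omega> u G)"

definition wdiv :: "(real^'d::finite) set \<Rightarrow> (real^'d \<Rightarrow> real^'d) \<Rightarrow> real^'d \<Rightarrow> real" where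
  "wdiv \<Omega> u x = (\<Sum>i\<in>UNIV. wgrad \<Omega> u x $ i $ i)"

text \<open>H^{-1}(Omega)^d: bounded linear functionals on H^1_0(Omega)^d.
  The duality pairing of f with v is written F v.\<close>
definition Hm1 :: "(real^'d::finite) set \<Rightarrow> ((real^'d \<Rightarrow> real^'d) \<Rightarrow> real) set" where
  "Hm1 \<Omega> = {F. (\<forall>v w a b. v \<in> H10 \<Omega> \<longrightarrow> w \<in> H10 \<Omega> \<longrightarrow>
                   F (\<lambda>x. a *\<^sub>R v x + b *\<^sub>R w x) = a * F v + b * F w)
             \<and> (\<exists>C. \<forall>v\<in>H10 \<Omega>. \<bar>F v\<bar> \<le> C * sqrt (integral\<^sup>L (lebesgue_on \<Omega>)
                     (\<lambda>x. (norm (v x))\<^sup>2 + (norm (wgrad \<Omega> v x))\<^sup>2)))}"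

definition conv_form :: "(real^'d::finite) set \<Rightarrow> (real^'d \<Rightarrow> real^'d) \<Rightarrow> (real^'d \<Rightarrow> real^'d)
    \<Rightarrow> (real^'d \<Rightarrow> real^'d) \<Rightarrow> real" where
  "conv_form \<Omega> w z v =
     integral\<^sup>L (lebesgue_on \<Omega>) (\<lambda>x. (wgrad \<Omega> z x *v w x) \<bullet> v x)
     + (1/2) * integral\<^sup>L (lebesgue_on \<Omega>) (\<lambda>x. wdiv \<Omega> w x * (z x \<bullet> v x))"

end

theory Submission
  imports Defs
begin

text \<open>
  The momentum equation is tested with \<open>v = 3/2 u\<^sub>n\<^sub>+\<^sub>1 - u\<^sub>n + 1/2 u\<^sub>n\<^sub>-\<^sub>1\<close>, which by the update step equals
  \<open>u\<^sup>1\<^sub>n\<^sub>+\<^sub>1\<close> almost everywhere, and the continuity equation with \<open>p\<^sub>n\<^sub>+\<^sub>1\<close>. The time differences become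
  telescoping energies by the \<open>G\<close>-stability identity of the method, so all that remains is that the
  skew-symmetrized convective form vanishes when its last two arguments agree. This is integration by
  parts once the trilinear integrals are known to converge: in dimension 2 and 3, Ladyzhenskaya's
  inequality \<open>\<parallel>\<phi>\<parallel>\<^sub>4 \<le> C \<parallel>\<phi>\<parallel>\<close> (with the \<open>H\<^sup>1\<close> norm on the right) makes the approximating test
  functions converge in \<open>L\<^sup>4\<close>. Since products of test functions are test functions, any
  square-integrable weak gradient can be paired with them directly, and its uniqueness is not needed.
\<close>

section \<open>Smooth functions with compact support\<close>

text \<open>The entries of a weak gradient are merely square-integrable, so an integral of such an
  entry times two velocity components makes sense once the product of those components is
  square-integrable, which fourth-power integrability of each one guarantees. Integrability has to
  be carried along everywhere: the Bochner integral of a non-integrable function is 0 by convention,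
  so additivity can fail without it. The estimate for test functions is therefore done with
  nonnegative extended integrals, where Fubini and monotonicity ask only for measurability, and
  ordinary integrals return afterwards. A second difficulty is that \<open>wgrad\<close> is a choice
  among weak gradients, whereas \<open>H10\<close> provides convergence of the approximating
  gradients only to its own witness; the two are linked solely through the identities obtained by
  testing. The coefficients 3/2, -1, 1/2 of the test field come from solving the update step for
  \<open>u1 (n+1)\<close>.\<close>

lemma has_derivative_imp_partial:
  assumes "(f has_derivative f') (at x)"
  shows "partial j f x = f' (axis j 1)"
  using frechet_derivative_at[OF assms] by (simp add: partial_def)

lemma partial_add:
  assumes "f differentiable (at x)" "g differentiable (at x)"
  shows "partial j (\<lambda>x. f x + g x) x = partial j f x + partial j g x"
  using has_derivative_imp_partial[OF has_derivative_add[OF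
      assms[unfolded frechet_derivative_works]]]
  by (simp add: partial_def)

lemma partial_mult:
  fixes f g :: "real^'d \<Rightarrow> real"
  assumes "f differentiable (at x)" "g differentiable (at x)"
  shows "partial j (\<lambda>x. f x * g x) x = f x * partial j g x + partial j f x * g x"
  using has_derivative_imp_partial[OF has_derivative_mult[OF
      assms[unfolded frechet_derivative_works]]]
  by (simp add: partial_def)

lemma partial_bounded_linear:
  assumes "bounded_linear h" "f differentiable (at x)"
  shows "partial j (\<lambda>x. h (f x)) x = h (partial j f x)"
  using has_derivative_imp_partial[OF bounded_linear.has_derivative[OF assms(1)
      assms(2)[unfolded frechet_derivative_works]]]
  by (simp add: partial_def)

text \<open>The complement of the closed support is open, so \<open>f\<close> agrees with the zero
  function near \<open>x\<close> and shares its derivative there. This keeps derivatives of test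
  functions compactly supported inside \<open>\<Omega>\<close>.\<close>

lemma partial_eq_0_outside_support:
  assumes "x \<notin> closure {x. f x \<noteq> 0}"
  shows "partial j f x = 0"
proof -
  have "((\<lambda>x. 0) has_derivative (\<lambda>x. 0)) (at x)" by simp
  then have "(f has_derivative (\<lambda>x. 0)) (at x)"
    by (rule has_derivative_transform_within_open[of _ _ _ _ "- closure {x. f x \<noteq> 0}"])
      (use assms closure_subset[of "{x. f x \<noteq> 0}"] in auto)
  from has_derivative_imp_partial[OF this] show ?thesis .
qed

text \<open>Differentiating innermost first makes the class of \<open>n + 1\<close> times differentiable functions
  amenable to induction on \<open>n\<close>, which \<^const>\<open>iter_partial\<close>, adding outermost derivatives, is not.\<close>

fun diff_upto :: "nat \<Rightarrow> (real^'d::finite \<Rightarrow> 'b::real_normed_vector) \<Rightarrow> bool" where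
  "diff_upto 0 f \<longleftrightarrow> (\<forall>x. f differentiable (at x))"
| "diff_upto (Suc n) f \<longleftrightarrow> (\<forall>x. f differentiable (at x)) \<and> (\<forall>j. diff_upto n (partial j f))"

lemma diff_upto_SucD: "diff_upto (Suc n) f \<Longrightarrow> diff_upto n f"
  by (induction n arbitrary: f) auto

lemma iter_partial_snoc: "iter_partial (js @ [j]) f = iter_partial js (partial j f)"
  by (induction js) auto

text \<open>A nonempty list is split at its last index, which is the derivative that
  \<open>iter_partial\<close> takes first and \<open>diff_upto\<close> peels off first.\<close>

lemma diff_upto_iff: "diff_upto n f \<longleftrightarrow> (\<forall>js x. length js \<le> n \<longrightarrow> iter_partial js f differentiable (at x))"
proof (induction n arbitrary: f)
  case (Suc n)
  have "(\<forall>js x. length js \<le> Suc n \<longrightarrow> iter_partial js f differentiable (at x)) \<longleftrightarrow>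
      (\<forall>x. f differentiable (at x)) \<and>
      (\<forall>j js x. length js \<le> n \<longrightarrow> iter_partial js (partial j f) differentiable (at x))" (is "?L = ?R")
  proof
    assume L: ?L
    show ?R
    proof (intro conjI allI impI)
      fix x show "f differentiable (at x)" using L[rule_format, of "[]"] by simp
    next
      fix j js x assume "length (js :: 'a list) \<le> n"
      then show "iter_partial js (partial j f) differentiable (at x)"
        using L[rule_format, of "js @ [j]"] by (simp add: iter_partial_snoc)
    qed
  next
    assume R: ?R
    show ?L
    proof (intro allI impI)
      fix js x assume "length (js :: 'a list) \<le> Suc n"
      then show "iter_partial js f differentiable (at x)"
        using R by (cases js rule: rev_cases) (auto simp: iter_partial_snoc)
    qed
  qed
  then show ?case by (simp only: diff_upto.simps Suc)
qed simp

lemma smooth_fun_iff: "smooth_fun f \<longleftrightarrow> (\<forall>n. diff_upto n f)"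
  unfolding smooth_fun_def diff_upto_iff by auto

lemma diff_upto_add:
  "diff_upto n f \<Longrightarrow> diff_upto n g \<Longrightarrow> diff_upto n (\<lambda>x. f x + g x)"
proof (induction n arbitrary: f g)
  case (Suc n)
  then have "partial j (\<lambda>x. f x + g x) = (\<lambda>x. partial j f x + partial j g x)" for j
    by (auto simp: partial_add)
  with Suc show ?case by auto
qed auto

lemma differentiable_bounded_linear:
  "bounded_linear h \<Longrightarrow> f differentiable F \<Longrightarrow> (\<lambda>x. h (f x)) differentiable F"
  unfolding differentiable_def using bounded_linear.has_derivative by blast

lemma diff_upto_bounded_linear:
  "bounded_linear h \<Longrightarrow> diff_upto n f \<Longrightarrow> diff_upto n (\<lambda>x. h (f x))"
proof (induction n arbitrary: f)
  case 0
  then show ?case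
    using differentiable_bounded_linear[of h f] by auto
next
  case (Suc n)
  then have "partial j (\<lambda>x. h (f x)) = (\<lambda>x. h (partial j f x))" for j
    by (auto simp: partial_bounded_linear)
  with Suc show ?case
    using differentiable_bounded_linear[of h f] by auto
qed

lemma diff_upto_mult:
  fixes f g :: "real^'d \<Rightarrow> real"
  shows "diff_upto n f \<Longrightarrow> diff_upto n g \<Longrightarrow> diff_upto n (\<lambda>x. f x * g x)"
proof (induction n arbitrary: f g)
  case 0
  then show ?case by (auto intro: differentiable_mult)
next
  case (Suc n)
  then have "partial j (\<lambda>x. f x * g x) = (\<lambda>x. f x * partial j g x + partial j f x * g x)" for j
    by (auto simp: partial_mult)
  \<comment> \<open>In the Leibniz sum each derivative is multiplied by an undifferentiated factor,
    so the induction hypothesis is applied to \<open>f\<close> and \<open>g\<close> themselves at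
    the lower level \<open>n\<close>.\<close>
  with Suc diff_upto_SucD[of n f] diff_upto_SucD[of n g] show ?case
    by (auto intro!: diff_upto_add differentiable_mult)
qed

section \<open>Closure properties of test functions\<close>

lemma closure_support_mono:
  assumes "compact (closure {x. f x \<noteq> 0})" "closure {x. f x \<noteq> 0} \<subseteq> \<Omega>" "\<And>x. f x = 0 \<Longrightarrow> g x = 0"
  shows "compact (closure {x. g x \<noteq> 0}) \<and> closure {x. g x \<noteq> 0} \<subseteq> \<Omega>"
proof -
  have "closure {x. g x \<noteq> 0} \<subseteq> closure {x. f x \<noteq> 0}"
    by (rule closure_mono) (use assms(3) in auto)
  then show ?thesis
    using assms(1,2) compact_Int_closed[OF assms(1) closed_closure[of "{x. g x \<noteq> 0}"]]
    by (auto simp: Int_absorb1)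
qed

lemma test_fun_add:
  assumes "test_fun \<Omega> f" "test_fun \<Omega> g"
  shows "test_fun \<Omega> (\<lambda>x. f x + g x)"
proof -
  have "closure {x. f x + g x \<noteq> 0} \<subseteq> closure ({x. f x \<noteq> 0} \<union> {x. g x \<noteq> 0})"
    by (rule closure_mono) auto
  then have sub: "closure {x. f x + g x \<noteq> 0} \<subseteq> closure {x. f x \<noteq> 0} \<union> closure {x. g x \<noteq> 0}"
    by (simp only: closure_Un)
  have "compact (closure {x. f x \<noteq> 0} \<union> closure {x. g x \<noteq> 0})"
    using assms by (auto simp: test_fun_def)
  from compact_Int_closed[OF this closed_closure[of "{x. f x + g x \<noteq> 0}"]] sub
  show ?thesis
    using assms by (auto simp: test_fun_def smooth_fun_iff diff_upto_add Int_absorb1)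
qed

lemma test_fun_bounded_linear:
  assumes "bounded_linear h" "test_fun \<Omega> f"
  shows "test_fun \<Omega> (\<lambda>x. h (f x))"
  using assms closure_support_mono[of f \<Omega> "\<lambda>x. h (f x)"]
  by (auto simp: test_fun_def smooth_fun_iff diff_upto_bounded_linear linear_simps(3))

lemma test_fun_mult:
  fixes f g :: "real^'d \<Rightarrow> real"
  assumes "test_fun \<Omega> f" "test_fun \<Omega> g"
  shows "test_fun \<Omega> (\<lambda>x. f x * g x)"
  using assms closure_support_mono[of f \<Omega> "\<lambda>x. f x * g x"]
  by (auto simp: test_fun_def smooth_fun_iff diff_upto_mult)

lemma test_fun_differentiable: "test_fun \<Omega> f \<Longrightarrow> f differentiable (at x)"
  unfolding test_fun_def smooth_fun_def by (metis iter_partial.simps(1))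

lemma test_fun_eq_0: "test_fun \<Omega> f \<Longrightarrow> x \<notin> \<Omega> \<Longrightarrow> f x = 0"
  unfolding test_fun_def using closure_subset[of "{x. f x \<noteq> 0}"] by auto

lemma test_fun_partial:
  assumes "test_fun \<Omega> f"
  shows "test_fun \<Omega> (partial j f)"
proof -
  have "closure {x. partial j f x \<noteq> 0} \<subseteq> closure {x. f x \<noteq> 0}"
    using partial_eq_0_outside_support[of _ f j] by (intro closure_minimal) auto
  moreover have "smooth_fun (partial j f)"
    unfolding smooth_fun_iff using assms[unfolded test_fun_def smooth_fun_iff]
    by (metis diff_upto.simps(2))
  ultimately show ?thesis
    using assms compact_Int_closed[of "closure {x. f x \<noteq> 0}" "closure {x. partial j f x \<noteq> 0}"]
    by (auto simp: test_fun_def Int_absorb1)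
qed

lemma test_fun_continuous: "test_fun \<Omega> f \<Longrightarrow> continuous_on S f"
  by (meson continuous_at_imp_continuous_on differentiable_imp_continuous_within test_fun_differentiable)

lemma test_fun_borel: "test_fun \<Omega> f \<Longrightarrow> f \<in> borel_measurable borel"
  by (rule borel_measurable_continuous_onI) (rule test_fun_continuous)

lemma test_fun_vanishes_at_infinity:
  assumes "test_fun \<Omega> f"
  obtains B where "\<And>x. norm x > B \<Longrightarrow> f x = 0"
proof -
  have "bounded (closure {x. f x \<noteq> 0})"
    using assms by (auto simp: test_fun_def compact_imp_bounded)
  then obtain B where B: "\<And>x. x \<in> closure {x. f x \<noteq> 0} \<Longrightarrow> norm x \<le> B"
    by (auto simp: bounded_iff)
  have "f x = 0" if "norm x > B" for x
    using B[of x] that closure_subset[of "{x. f x \<noteq> 0}"] by fastforce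
  then show ?thesis using that by blast
qed

text \<open>A test function vanishes off \<open>\<Omega>\<close>, so integrating over the domain or
  over the whole space makes no difference. The second part, which concerns the positive part of
  \<open>f\<close>, moves estimates to \<open>lborel\<close>, where coordinates can be integrated
  one at a time.\<close>

lemma test_fun_integrable:
  fixes f :: "real^'d \<Rightarrow> real"
  assumes \<Omega>: "open \<Omega>" and f: "test_fun \<Omega> f"
  shows "integrable (lebesgue_on \<Omega>) f"
    and "nn_integral (lebesgue_on \<Omega>) (\<lambda>x. ennreal (f x)) = nn_integral lborel (\<lambda>x. ennreal (f x))"
proof -
  let ?K = "closure {x. f x \<noteq> 0}"
  have K: "compact ?K" using f by (auto simp: test_fun_def)
  have "integrable lborel (\<lambda>x. indicator ?K x *\<^sub>R f x)"
    by (rule borel_integrable_compact[OF K test_fun_continuous[OF f]])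
  also have "(\<lambda>x. indicator ?K x *\<^sub>R f x) = (\<lambda>x. indicator \<Omega> x *\<^sub>R f x)"
    using closure_subset[of "{x. f x \<noteq> 0}"] test_fun_eq_0[OF f]
    by (auto simp: indicator_def fun_eq_iff)
  finally have "integrable lborel (\<lambda>x. indicator \<Omega> x *\<^sub>R f x)" .
  then have "integrable lebesgue (\<lambda>x. indicator \<Omega> x *\<^sub>R f x)"
    by (subst integrable_completion) auto
  then show "integrable (lebesgue_on \<Omega>) f"
    using \<Omega> by (subst integrable_restrict_space) (auto simp: mult.commute)
  have "nn_integral (lebesgue_on \<Omega>) (\<lambda>x. ennreal (f x)) = nn_integral lebesgue (\<lambda>x. ennreal (f x) * indicator \<Omega> x)"
    using \<Omega> by (subst nn_integral_restrict_space) auto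
  also have "(\<lambda>x. ennreal (f x) * indicator \<Omega> x) = (\<lambda>x. ennreal (f x))"
    using test_fun_eq_0[OF f] by (auto simp: indicator_def fun_eq_iff)
  finally show "nn_integral (lebesgue_on \<Omega>) (\<lambda>x. ennreal (f x)) = nn_integral lborel (\<lambda>x. ennreal (f x))"
    by (simp add: nn_integral_completion)
qed

section \<open>Ladyzhenskaya's inequality\<close>

text \<open>Along a coordinate line the square of \<open>f\<close> starts from 0 far out, so its
  value at \<open>s\<close> is the integral of its derivative up to \<open>s\<close>. Extending the
  absolute value of that derivative to the full line yields a bound that no longer depends on
  \<open>s\<close>; this loss of one variable drives Ladyzhenskaya's inequality.\<close>

lemma test_fun_square_le_line_integral:
  fixes f :: "real^'d \<Rightarrow> real"
  assumes f: "test_fun \<Omega> f"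
  shows "(ennreal \<bar>f (y + s *\<^sub>R axis i 1)\<bar>)\<^sup>2
    \<le> (\<integral>\<^sup>+t. 2 * ennreal \<bar>f (y + t *\<^sub>R axis i 1)\<bar> * ennreal \<bar>partial i f (y + t *\<^sub>R axis i 1)\<bar> \<partial>lborel)"
proof -
  obtain B where B: "\<And>x. norm x > B \<Longrightarrow> f x = 0"
    using test_fun_vanishes_at_infinity[OF f] by blast
  let ?l = "\<lambda>t. y + t *\<^sub>R axis i (1::real)"
  \<comment> \<open>The point at parameter \<open>a\<close> has norm at least
    \<open>\<bar>a\<bar> - norm y\<close>, which exceeds \<open>B\<close>, so \<open>f\<close>
    vanishes there; the minimum with \<open>s\<close> makes \<open>{a..s}\<close> a genuine
    interval.\<close>
  define a where "a = min s (- (\<bar>B\<bar> + norm y + 1))"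
  have a: "a \<le> s" "\<bar>a\<bar> > B + norm y" by (auto simp: a_def)
  have "\<bar>a\<bar> \<le> norm (?l a) + norm y"
    using norm_triangle_ineq4[of "?l a" y] by (simp add: norm_axis_1)
  then have fa: "f (?l a) = 0" using a by (intro B) linarith
  have d: "((\<lambda>t. (f (?l t))\<^sup>2) has_vector_derivative 2 * f (?l t) * partial i f (?l t)) (at t within S)" for t S
  proof -
    have 1: "(f has_derivative frechet_derivative f (at (?l t))) (at (?l t))"
      using test_fun_differentiable[OF f] by (simp add: frechet_derivative_works)
    have 2: "(?l has_derivative (\<lambda>h. h *\<^sub>R axis i 1)) (at t within S)"
      by (auto intro!: derivative_eq_intros)
    have "((\<lambda>t. f (?l t)) has_derivative (\<lambda>h. frechet_derivative f (at (?l t)) (h *\<^sub>R axis i 1))) (at t within S)"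
      by (rule has_derivative_compose[OF 2 1])
    also have "(\<lambda>h. frechet_derivative f (at (?l t)) (h *\<^sub>R axis i 1)) = (\<lambda>h. h * partial i f (?l t))"
      using linear_scale[OF has_derivative_linear[OF 1]] by (simp add: partial_def)
    finally have "((\<lambda>t. f (?l t)) has_field_derivative partial i f (?l t)) (at t within S)"
      by (simp add: has_field_derivative_def mult_commute_abs)
    from DERIV_power[OF this, of 2] show ?thesis
      by (simp add: has_real_derivative_iff_has_vector_derivative mult_ac)
  qed
  have cont: "continuous_on {a..s} (\<lambda>t. 2 * f (?l t) * partial i f (?l t))"
    by (intro continuous_intros continuous_on_compose2[OF test_fun_continuous[OF f, of UNIV]]
        continuous_on_compose2[OF test_fun_continuous[OF test_fun_partial[OF f, of i], of UNIV]]) auto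
  have hb: "has_bochner_integral lborel (\<lambda>t. indicator {a..s} t *\<^sub>R (2 * f (?l t) * partial i f (?l t)))
      ((f (?l s))\<^sup>2 - (f (?l a))\<^sup>2)"
    by (rule has_bochner_integral_FTC_Icc[OF a(1) d cont])
  have "(ennreal \<bar>f (?l s)\<bar>)\<^sup>2 = ennreal (norm (LINT t|lborel. indicator {a..s} t *\<^sub>R (2 * f (?l t) * partial i f (?l t))))"
    using hb fa by (simp add: has_bochner_integral_iff ennreal_power)
  also have "\<dots> \<le> (\<integral>\<^sup>+t. ennreal (norm (indicator {a..s} t *\<^sub>R (2 * f (?l t) * partial i f (?l t)))) \<partial>lborel)"
    using hb by (intro integral_norm_bound_ennreal) (simp add: has_bochner_integral_iff)
  also have "\<dots> \<le> (\<integral>\<^sup>+t. 2 * ennreal \<bar>f (?l t)\<bar> * ennreal \<bar>partial i f (?l t)\<bar> \<partial>lborel)"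
    by (intro nn_integral_mono) (auto simp: indicator_def abs_mult ennreal_mult')
  finally show ?thesis .
qed

text \<open>Lebesgue measure is the image of a product measure indexed by the basis vectors, and the
  two factors are split off one after the other. Naming the coordinates \<open>i\<close> and
  \<open>j\<close> lets the result apply to any two-element index type.\<close>

lemma nn_integral_lborel_plane:
  fixes F :: "real^'d \<Rightarrow> ennreal"
  assumes ij: "UNIV = {i, j}" "i \<noteq> j" and [measurable]: "F \<in> borel_measurable borel"
  shows "nn_integral lborel F =
    (\<integral>\<^sup>+x. \<integral>\<^sup>+y. F (x *\<^sub>R axis i 1 + y *\<^sub>R axis j 1) \<partial>lborel \<partial>lborel)"
proof -
  interpret product_sigma_finite "\<lambda>_. lborel :: real measure" ..
  let ?e = "\<lambda>i::'d. axis i (1::real)"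
  have B: "Basis = {?e i, ?e j}" "?e i \<noteq> ?e j"
    using ij by (auto simp: Basis_vec_def axis_eq_axis)
  have "nn_integral lborel F =
      (\<integral>\<^sup>+f. F (\<Sum>b\<in>{?e i, ?e j}. f b *\<^sub>R b) \<partial>(\<Pi>\<^sub>M b\<in>{?e i, ?e j}. lborel))"
    by (subst lborel_eq, subst nn_integral_distr) (simp_all add: B(1))
  also have "\<dots> = (\<integral>\<^sup>+x. \<integral>\<^sup>+f. F (x *\<^sub>R ?e i + f (?e j) *\<^sub>R ?e j) \<partial>(\<Pi>\<^sub>M b\<in>{?e j}. lborel) \<partial>lborel)"
    using B(2) by (subst product_nn_integral_insert_rev) (auto simp del: scaleR_left_distrib)
  also have "\<dots> = (\<integral>\<^sup>+x. \<integral>\<^sup>+y. F (x *\<^sub>R ?e i + y *\<^sub>R ?e j) \<partial>lborel \<partial>lborel)"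
    by (intro nn_integral_cong product_nn_integral_singleton) simp
  finally show ?thesis .
qed

lemma nn_integral_lborel_space:
  fixes F :: "real^'d \<Rightarrow> ennreal"
  assumes ijk: "UNIV = {i, j, k}" "i \<noteq> j" "i \<noteq> k" "j \<noteq> k" and [measurable]: "F \<in> borel_measurable borel"
  shows "nn_integral lborel F =
    (\<integral>\<^sup>+x. \<integral>\<^sup>+y. \<integral>\<^sup>+z. F (x *\<^sub>R axis i 1 + (y *\<^sub>R axis j 1 + z *\<^sub>R axis k 1)) \<partial>lborel \<partial>lborel \<partial>lborel)"
proof -
  interpret product_sigma_finite "\<lambda>_. lborel :: real measure" ..
  let ?e = "\<lambda>i::'d. axis i (1::real)"
  have B: "Basis = {?e i, ?e j, ?e k}" "?e i \<noteq> ?e j" "?e i \<noteq> ?e k" "?e j \<noteq> ?e k"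
    using ijk by (auto simp: Basis_vec_def axis_eq_axis)
  have "nn_integral lborel F =
      (\<integral>\<^sup>+f. F (\<Sum>b\<in>{?e i, ?e j, ?e k}. f b *\<^sub>R b) \<partial>(\<Pi>\<^sub>M b\<in>{?e i, ?e j, ?e k}. lborel))"
    by (subst lborel_eq, subst nn_integral_distr) (simp_all add: B(1))
  also have "\<dots> = (\<integral>\<^sup>+x. \<integral>\<^sup>+f. F (x *\<^sub>R ?e i + (f (?e j) *\<^sub>R ?e j + f (?e k) *\<^sub>R ?e k)) \<partial>(\<Pi>\<^sub>M b\<in>{?e j, ?e k}. lborel) \<partial>lborel)"
    using B(2-4) by (subst product_nn_integral_insert_rev) (auto simp del: scaleR_left_distrib)
  also have "\<dots> = (\<integral>\<^sup>+x. \<integral>\<^sup>+y. \<integral>\<^sup>+f. F (x *\<^sub>R ?e i + (y *\<^sub>R ?e j + f (?e k) *\<^sub>R ?e k)) \<partial>(\<Pi>\<^sub>M b\<in>{?e k}. lborel) \<partial>lborel \<partial>lborel)"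
    using B(2-4) by (subst product_nn_integral_insert_rev) (auto simp del: scaleR_left_distrib)
  also have "\<dots> = (\<integral>\<^sup>+x. \<integral>\<^sup>+y. \<integral>\<^sup>+z. F (x *\<^sub>R ?e i + (y *\<^sub>R ?e j + z *\<^sub>R ?e k)) \<partial>lborel \<partial>lborel \<partial>lborel)"
    by (intro nn_integral_cong product_nn_integral_singleton) simp
  finally show ?thesis .
qed

text \<open>One bound on \<open>F\<close> is free of \<open>x\<close>, the other free of
  \<open>y\<close>. Using each once in the square separates the variables, so the double integral of
  their product factors; Fubini then restores the order of integration in the first factor.\<close>

lemma nn_integral_square_le_plane:
  fixes F H K :: "real \<Rightarrow> real \<Rightarrow> ennreal"
  assumes [measurable]: "case_prod H \<in> borel_measurable (lborel \<Otimes>\<^sub>M lborel)"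
      "case_prod K \<in> borel_measurable (lborel \<Otimes>\<^sub>M lborel)"
    and H: "\<And>x y. F x y \<le> (\<integral>\<^sup>+t. H t y \<partial>lborel)"
    and K: "\<And>x y. F x y \<le> (\<integral>\<^sup>+t. K x t \<partial>lborel)"
  shows "(\<integral>\<^sup>+x. \<integral>\<^sup>+y. (F x y)\<^sup>2 \<partial>lborel \<partial>lborel)
    \<le> (\<integral>\<^sup>+x. \<integral>\<^sup>+y. H x y \<partial>lborel \<partial>lborel) * (\<integral>\<^sup>+x. \<integral>\<^sup>+y. K x y \<partial>lborel \<partial>lborel)"
proof -
  have "(\<integral>\<^sup>+x. \<integral>\<^sup>+y. (F x y)\<^sup>2 \<partial>lborel \<partial>lborel)
      \<le> (\<integral>\<^sup>+x. \<integral>\<^sup>+y. (\<integral>\<^sup>+t. H t y \<partial>lborel) * (\<integral>\<^sup>+t. K x t \<partial>lborel) \<partial>lborel \<partial>lborel)"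
    by (intro nn_integral_mono) (simp add: power2_eq_square mult_mono H K)
  also have "\<dots> = (\<integral>\<^sup>+y. \<integral>\<^sup>+t. H t y \<partial>lborel \<partial>lborel) * (\<integral>\<^sup>+x. \<integral>\<^sup>+y. K x y \<partial>lborel \<partial>lborel)"
    by (simp add: nn_integral_multc nn_integral_cmult)
  also have "(\<integral>\<^sup>+y. \<integral>\<^sup>+t. H t y \<partial>lborel \<partial>lborel) = (\<integral>\<^sup>+x. \<integral>\<^sup>+y. H x y \<partial>lborel \<partial>lborel)"
    by (rule lborel_pair.Fubini') simp
  finally show ?thesis .
qed

lemma ennreal_two_mult_le: "2 * a * b \<le> a\<^sup>2 + (b::ennreal)\<^sup>2"
proof (cases a; cases b)
  fix r s assume "a = ennreal r" "0 \<le> r" "b = ennreal s" "0 \<le> s"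
  moreover have "2 * r * s \<le> r\<^sup>2 + s\<^sup>2" by (rule sum_squares_bound)
  moreover have "2 * ennreal r = ennreal (2 * r)" using \<open>0 \<le> r\<close> by (simp add: ennreal_mult')
  ultimately show ?thesis
    by (simp add: ennreal_power flip: ennreal_mult ennreal_plus)
qed (auto simp: power2_eq_square ennreal_mult_top ennreal_top_mult)

text \<open>The fourth power is the square of \<open>f\<close> squared, which has a line bound in
  each of the two directions. By 2ab \<le> a^2 + b^2 each of the resulting integrals of
  \<open>?H\<close> is at most the energy \<open>?E\<close>.\<close>

lemma ladyzhenskaya_plane:
  fixes f :: "real^'d \<Rightarrow> real"
  assumes f: "test_fun \<Omega> f" and ij: "(UNIV :: 'd set) = {i, j}" "i \<noteq> j"
  shows "(\<integral>\<^sup>+x. (ennreal \<bar>f x\<bar>)^4 \<partial>lborel)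
    \<le> 8 * (\<integral>\<^sup>+x. (ennreal \<bar>f x\<bar>)\<^sup>2 + (\<Sum>l\<in>UNIV. (ennreal \<bar>partial l f x\<bar>)\<^sup>2) \<partial>lborel)\<^sup>2"
proof -
  note [measurable] = test_fun_borel[OF f] test_fun_borel[OF test_fun_partial[OF f]]
  let ?P = "\<lambda>x y. x *\<^sub>R axis i 1 + y *\<^sub>R axis j (1::real)"
  let ?E = "\<integral>\<^sup>+x. (ennreal \<bar>f x\<bar>)\<^sup>2 + (\<Sum>l\<in>UNIV. (ennreal \<bar>partial l f x\<bar>)\<^sup>2) \<partial>lborel"
  let ?H = "\<lambda>l x. 2 * ennreal \<bar>f x\<bar> * ennreal \<bar>partial l f x\<bar>"
  have H: "nn_integral lborel (?H l) \<le> ?E" for l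
    by (intro nn_integral_mono order.trans[OF ennreal_two_mult_le] add_left_mono)
       (auto intro: member_le_sum)
  have "(\<integral>\<^sup>+x. (ennreal \<bar>f x\<bar>)^4 \<partial>lborel) = (\<integral>\<^sup>+x. \<integral>\<^sup>+y. ((ennreal \<bar>f (?P x y)\<bar>)\<^sup>2)\<^sup>2 \<partial>lborel \<partial>lborel)"
    by (subst nn_integral_lborel_plane[OF ij]) (auto simp flip: power_mult)
  also have "\<dots> \<le> (\<integral>\<^sup>+x. \<integral>\<^sup>+y. ?H i (?P x y) \<partial>lborel \<partial>lborel) * (\<integral>\<^sup>+x. \<integral>\<^sup>+y. ?H j (?P x y) \<partial>lborel \<partial>lborel)"
  proof (rule nn_integral_square_le_plane)
    show "(ennreal \<bar>f (?P x y)\<bar>)\<^sup>2 \<le> (\<integral>\<^sup>+t. ?H i (?P t y) \<partial>lborel)" for x y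
      using test_fun_square_le_line_integral[OF f, of "y *\<^sub>R axis j 1" x i] by (simp add: add.commute)
    show "(ennreal \<bar>f (?P x y)\<bar>)\<^sup>2 \<le> (\<integral>\<^sup>+t. ?H j (?P x t) \<partial>lborel)" for x y
      by (rule test_fun_square_le_line_integral[OF f])
  qed measurable
  also have "\<dots> = nn_integral lborel (?H i) * nn_integral lborel (?H j)"
    by (subst (1 2) nn_integral_lborel_plane[OF ij]) auto
  also have "\<dots> \<le> 1 * (?E * ?E)"
    by (simp add: mult_mono H)
  \<comment> \<open>The plane gives the constant 1; it is relaxed to 8, the constant of the
    three-dimensional case, so that both dimensions share one estimate.\<close>
  also have "\<dots> \<le> 8 * (?E * ?E)"
    by (intro mult_right_mono) auto
  finally show ?thesis by (simp add: power2_eq_square)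
qed

text \<open>The planar estimate on each slice \<open>x = const\<close> bounds the slice integral of \<open>f\<^sup>4\<close> by
  \<open>4 S(x)\<close> times the squared gradient, where the slice mass \<open>S(x)\<close> of \<open>f\<^sup>2\<close> is bounded uniformly in
  \<open>x\<close> by integrating the line estimate in the direction transversal to the slice.\<close>

lemma ladyzhenskaya_space:
  fixes f :: "real^'d \<Rightarrow> real"
  assumes f: "test_fun \<Omega> f" and ijk: "(UNIV :: 'd set) = {i, j, k}" "i \<noteq> j" "i \<noteq> k" "j \<noteq> k"
  shows "(\<integral>\<^sup>+x. (ennreal \<bar>f x\<bar>)^4 \<partial>lborel)
    \<le> 8 * (\<integral>\<^sup>+x. (ennreal \<bar>f x\<bar>)\<^sup>2 + (\<Sum>l\<in>UNIV. (ennreal \<bar>partial l f x\<bar>)\<^sup>2) \<partial>lborel)\<^sup>2"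
proof -
  note [measurable] = test_fun_borel[OF f] test_fun_borel[OF test_fun_partial[OF f]]
  let ?P = "\<lambda>x y z. x *\<^sub>R axis i 1 + (y *\<^sub>R axis j 1 + z *\<^sub>R axis k (1::real))"
  let ?E = "\<integral>\<^sup>+x. (ennreal \<bar>f x\<bar>)\<^sup>2 + (\<Sum>l\<in>UNIV. (ennreal \<bar>partial l f x\<bar>)\<^sup>2) \<partial>lborel"
  let ?D = "\<lambda>l x. ennreal \<bar>partial l f x\<bar>"
  let ?H = "\<lambda>l x. 2 * ennreal \<bar>f x\<bar> * ?D l x"
  define S where "S x = (\<integral>\<^sup>+y. \<integral>\<^sup>+z. (ennreal \<bar>f (?P x y z)\<bar>)\<^sup>2 \<partial>lborel \<partial>lborel)" for x
  define A where "A l x = (\<integral>\<^sup>+y. \<integral>\<^sup>+z. (?D l (?P x y z))\<^sup>2 \<partial>lborel \<partial>lborel)" for l x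
  define Q where "Q l x = (\<integral>\<^sup>+y. \<integral>\<^sup>+z. ?H l (?P x y z) \<partial>lborel \<partial>lborel)" for l x
  have [measurable]: "A l \<in> borel_measurable borel" for l
    unfolding A_def by measurable
  have S: "S x \<le> ?E" for x
  proof -
    have "S x \<le> (\<integral>\<^sup>+y. \<integral>\<^sup>+z. \<integral>\<^sup>+t. ?H i (?P t y z) \<partial>lborel \<partial>lborel \<partial>lborel)"
      unfolding S_def
      using test_fun_square_le_line_integral[OF f, of "y *\<^sub>R axis j 1 + z *\<^sub>R axis k 1" x i for y z]
      by (intro nn_integral_mono) (simp add: add.commute)
    also have "\<dots> = (\<integral>\<^sup>+y. \<integral>\<^sup>+t. \<integral>\<^sup>+z. ?H i (?P t y z) \<partial>lborel \<partial>lborel \<partial>lborel)"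
      by (intro nn_integral_cong lborel_pair.Fubini') measurable
    also have "\<dots> = (\<integral>\<^sup>+t. \<integral>\<^sup>+y. \<integral>\<^sup>+z. ?H i (?P t y z) \<partial>lborel \<partial>lborel \<partial>lborel)"
      by (intro lborel_pair.Fubini') measurable
    also have "\<dots> = nn_integral lborel (?H i)"
      by (subst nn_integral_lborel_space[OF ijk]) auto
    also have "\<dots> \<le> ?E"
      by (intro nn_integral_mono order.trans[OF ennreal_two_mult_le] add_left_mono)
         (auto intro: member_le_sum)
    finally show ?thesis .
  qed
  \<comment> \<open>Cauchy-Schwarz on the slice, regarded as a product space. The factor 2 of
    \<open>?H\<close> is attached to \<open>f\<close>, which produces the 4.\<close>
  have Q: "(Q l x)\<^sup>2 \<le> 4 * (S x * A l x)" for l x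
  proof -
    let ?M = "lborel \<Otimes>\<^sub>M lborel :: (real \<times> real) measure"
    let ?F = "\<lambda>p. 2 * ennreal \<bar>f (?P x (fst p) (snd p))\<bar>"
    let ?G = "\<lambda>p. ?D l (?P x (fst p) (snd p))"
    have 1: "(\<integral>\<^sup>+p. ?F p * ?G p \<partial>?M) = Q l x"
      unfolding Q_def by (subst lborel.nn_integral_fst[symmetric]) simp_all
    have 2: "(\<integral>\<^sup>+p. (?F p)\<^sup>2 \<partial>?M) = 4 * S x"
      unfolding S_def
      by (subst lborel.nn_integral_fst[symmetric]) (simp_all add: power_mult_distrib nn_integral_cmult)
    have 3: "(\<integral>\<^sup>+p. (?G p)\<^sup>2 \<partial>?M) = A l x"
      unfolding A_def by (subst lborel.nn_integral_fst[symmetric]) simp_all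
    have "(\<integral>\<^sup>+p. ?F p * ?G p \<partial>?M)\<^sup>2 \<le> (\<integral>\<^sup>+p. (?F p)\<^sup>2 \<partial>?M) * (\<integral>\<^sup>+p. (?G p)\<^sup>2 \<partial>?M)"
      by (rule Cauchy_Schwarz_nn_integral) measurable
    from this[unfolded 1 2 3] show ?thesis by (simp only: mult.assoc)
  qed
  have "(\<integral>\<^sup>+x. (ennreal \<bar>f x\<bar>)^4 \<partial>lborel)
      = (\<integral>\<^sup>+x. \<integral>\<^sup>+y. \<integral>\<^sup>+z. ((ennreal \<bar>f (?P x y z)\<bar>)\<^sup>2)\<^sup>2 \<partial>lborel \<partial>lborel \<partial>lborel)"
    by (subst nn_integral_lborel_space[OF ijk]) (auto simp flip: power_mult)
  also have "\<dots> \<le> (\<integral>\<^sup>+x. 4 * ?E * (A j x + A k x) \<partial>lborel)"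
  proof (rule nn_integral_mono)
    fix x
    have "(\<integral>\<^sup>+y. \<integral>\<^sup>+z. ((ennreal \<bar>f (?P x y z)\<bar>)\<^sup>2)\<^sup>2 \<partial>lborel \<partial>lborel) \<le> Q j x * Q k x"
      unfolding Q_def
    proof (rule nn_integral_square_le_plane)
      show "(ennreal \<bar>f (?P x y z)\<bar>)\<^sup>2 \<le> (\<integral>\<^sup>+t. ?H j (?P x t z) \<partial>lborel)" for y z
        using test_fun_square_le_line_integral[OF f, of "x *\<^sub>R axis i 1 + z *\<^sub>R axis k 1" y j]
        by (simp add: ac_simps)
      show "(ennreal \<bar>f (?P x y z)\<bar>)\<^sup>2 \<le> (\<integral>\<^sup>+t. ?H k (?P x y t) \<partial>lborel)" for y z
        using test_fun_square_le_line_integral[OF f, of "x *\<^sub>R axis i 1 + y *\<^sub>R axis j 1" z k]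
        by (simp add: ac_simps)
    qed measurable
    \<comment> \<open>Doubling gives the product the form 2ab, which splits into two squares, each
      controlled by \<open>Q\<close>. With \<open>S x\<close> and the integrals of
      \<open>A j\<close> and \<open>A k\<close> all at most \<open>?E\<close>, this ends in 4
      \<open>?E\<close> (\<open>?E\<close> + \<open>?E\<close>), the source of the constant
      8.\<close>
    also have "\<dots> \<le> 2 * Q j x * Q k x"
      by (metis mult_2 le_iff_add distrib_right)
    also have "\<dots> \<le> (Q j x)\<^sup>2 + (Q k x)\<^sup>2"
      by (rule ennreal_two_mult_le)
    also have "\<dots> \<le> 4 * (?E * A j x) + 4 * (?E * A k x)"
      by (intro add_mono order.trans[OF Q] mult_mono S) auto
    finally show "(\<integral>\<^sup>+y. \<integral>\<^sup>+z. ((ennreal \<bar>f (?P x y z)\<bar>)\<^sup>2)\<^sup>2 \<partial>lborel \<partial>lborel) \<le> 4 * ?E * (A j x + A k x)"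
      by (simp add: distrib_left mult.assoc)
  qed
  also have "\<dots> = 4 * ?E * ((\<integral>\<^sup>+x. A j x \<partial>lborel) + (\<integral>\<^sup>+x. A k x \<partial>lborel))"
    by (simp add: nn_integral_cmult nn_integral_add)
  also have "\<dots> = 4 * ?E * ((\<integral>\<^sup>+x. (?D j x)\<^sup>2 \<partial>lborel) + (\<integral>\<^sup>+x. (?D k x)\<^sup>2 \<partial>lborel))"
    unfolding A_def by (subst (1 2) nn_integral_lborel_space[OF ijk]) auto
  also have "\<dots> \<le> 4 * ?E * (?E + ?E)"
  proof -
    have "(\<integral>\<^sup>+x. (?D l x)\<^sup>2 \<partial>lborel) \<le> ?E" for l
      by (intro nn_integral_mono add_increasing) (auto intro: member_le_sum)
    then show ?thesis by (intro mult_left_mono add_mono) auto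
  qed
  also have "\<dots> = 8 * ?E\<^sup>2"
  proof -
    have "4 * e * (e + e) = (4 + 4) * (e * e)" for e :: ennreal
      by (simp only: distrib_left distrib_right mult.assoc)
    then show ?thesis by (simp add: power2_eq_square)
  qed
  finally show ?thesis .
qed

section \<open>Square-integrable functions\<close>

lemma L2_real_iff:
  "f \<in> L2 \<Omega> \<longleftrightarrow> f \<in> borel_measurable (lebesgue_on \<Omega>) \<and> integrable (lebesgue_on \<Omega>) (\<lambda>x. (f x :: real)\<^sup>2)"
  by (simp add: L2_def)

lemma L2_measurable: "f \<in> L2 \<Omega> \<Longrightarrow> f \<in> borel_measurable (lebesgue_on \<Omega>)"
  by (simp add: L2_def)

lemma L2_scaleR:
  assumes "f \<in> L2 \<Omega>" shows "(\<lambda>x. c *\<^sub>R f x) \<in> L2 \<Omega>"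
  using assms by (auto simp: L2_def power_mult_distrib)

lemma norm_add_square_le:
  fixes a b :: "'a::real_normed_vector"
  shows "(norm (a + b))\<^sup>2 \<le> 2 * (norm a)\<^sup>2 + 2 * (norm b)\<^sup>2"
proof -
  have "(norm (a + b))\<^sup>2 \<le> (norm a + norm b)\<^sup>2" by (intro power_mono norm_triangle_ineq) auto
  also have "\<dots> \<le> 2 * (norm a)\<^sup>2 + 2 * (norm b)\<^sup>2"
    using sum_squares_bound[of "norm a" "norm b"] by (simp add: power2_sum)
  finally show ?thesis .
qed

lemma L2_add:
  assumes "f \<in> L2 \<Omega>" "g \<in> L2 \<Omega>" shows "(\<lambda>x. f x + g x) \<in> L2 \<Omega>"
proof -
  have [measurable]: "f \<in> borel_measurable (lebesgue_on \<Omega>)" "g \<in> borel_measurable (lebesgue_on \<Omega>)"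
    using assms by (auto simp: L2_def)
  have "integrable (lebesgue_on \<Omega>) (\<lambda>x. 2 * (norm (f x))\<^sup>2 + 2 * (norm (g x))\<^sup>2)"
    using assms by (auto simp: L2_def)
  then have "integrable (lebesgue_on \<Omega>) (\<lambda>x. (norm (f x + g x))\<^sup>2)"
    by (rule Bochner_Integration.integrable_bound) (use norm_add_square_le in auto)
  then show ?thesis by (simp add: L2_def)
qed

lemma L2_diff: "f \<in> L2 \<Omega> \<Longrightarrow> g \<in> L2 \<Omega> \<Longrightarrow> (\<lambda>x. f x - g x) \<in> L2 \<Omega>"
  using L2_add[of f \<Omega> "\<lambda>x. (-1) *\<^sub>R g x"] L2_scaleR[of g \<Omega> "-1"] by simp

lemma L2_bounded_linear:
  assumes "bounded_linear h" "f \<in> L2 \<Omega>" shows "(\<lambda>x. h (f x)) \<in> L2 \<Omega>"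
proof -
  have [measurable]: "f \<in> borel_measurable (lebesgue_on \<Omega>)" using assms by (auto simp: L2_def)
  have [measurable]: "h \<in> borel_measurable borel"
    by (intro borel_measurable_continuous_onI linear_continuous_on assms)
  obtain K where K: "\<And>x. norm (h x) \<le> norm x * K" using assms(1) bounded_linear.bounded by blast
  have le: "(norm (h y))\<^sup>2 \<le> K\<^sup>2 * (norm y)\<^sup>2" for y
    using power_mono[OF K[of y], of 2] by (simp add: power_mult_distrib mult.commute)
  have "integrable (lebesgue_on \<Omega>) (\<lambda>x. K\<^sup>2 * (norm (f x))\<^sup>2)"
    using assms by (auto simp: L2_def)
  then have "integrable (lebesgue_on \<Omega>) (\<lambda>x. (norm (h (f x)))\<^sup>2)"
    by (rule Bochner_Integration.integrable_bound) (use le in auto)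
  then show ?thesis by (simp add: L2_def)
qed

lemma L2_nth: "f \<in> L2 \<Omega> \<Longrightarrow> (\<lambda>x. f x $ i) \<in> L2 \<Omega>"
  by (rule L2_bounded_linear[OF bounded_linear_vec_nth])

lemma L2_inner_integrable:
  assumes "f \<in> L2 \<Omega>" "g \<in> L2 \<Omega>"
  shows "integrable (lebesgue_on \<Omega>) (\<lambda>x. f x \<bullet> g x)"
proof -
  have [measurable]: "f \<in> borel_measurable (lebesgue_on \<Omega>)" "g \<in> borel_measurable (lebesgue_on \<Omega>)"
    using assms by (auto simp: L2_def)
  have le: "\<bar>a \<bullet> b\<bar> \<le> (norm a)\<^sup>2 + (norm b)\<^sup>2" for a b :: 'b
  proof -
    have "2 * \<bar>a \<bullet> b\<bar> \<le> 2 * norm a * norm b" using Cauchy_Schwarz_ineq2[of a b] by simp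
    also have "\<dots> \<le> (norm a)\<^sup>2 + (norm b)\<^sup>2" by (rule sum_squares_bound)
    finally show ?thesis by simp
  qed
  have "integrable (lebesgue_on \<Omega>) (\<lambda>x. (norm (f x))\<^sup>2 + (norm (g x))\<^sup>2)"
    using assms by (auto simp: L2_def)
  then show ?thesis
    by (rule Bochner_Integration.integrable_bound) (use le in auto)
qed

lemma L2_mult_integrable:
  fixes f g :: "real^'d \<Rightarrow> real"
  shows "f \<in> L2 \<Omega> \<Longrightarrow> g \<in> L2 \<Omega> \<Longrightarrow> integrable (lebesgue_on \<Omega>) (\<lambda>x. f x * g x)"
  using L2_inner_integrable[of f \<Omega> g] by (simp add: mult.commute)

lemma L2_Cauchy_Schwarz:
  fixes f g :: "real^'d \<Rightarrow> real"
  assumes "f \<in> L2 \<Omega>" "g \<in> L2 \<Omega>"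
  shows "(\<integral>x. f x * g x \<partial>lebesgue_on \<Omega>)\<^sup>2
    \<le> (\<integral>x. (f x)\<^sup>2 \<partial>lebesgue_on \<Omega>) * (\<integral>x. (g x)\<^sup>2 \<partial>lebesgue_on \<Omega>)"
proof -
  let ?M = "lebesgue_on \<Omega>"
  have [measurable]: "f \<in> borel_measurable ?M" "g \<in> borel_measurable ?M"
    using assms by (auto simp: L2_def)
  have sq: "(\<integral>\<^sup>+x. (ennreal \<bar>h x\<bar>)\<^sup>2 \<partial>?M) = ennreal (\<integral>x. (h x)\<^sup>2 \<partial>?M)" if "h \<in> L2 \<Omega>" for h :: "real^'d \<Rightarrow> real"
    using that by (subst nn_integral_eq_integral[symmetric]) (auto simp: L2_real_iff ennreal_power)
  have "ennreal ((\<integral>x. f x * g x \<partial>?M)\<^sup>2) = (ennreal (norm (\<integral>x. f x * g x \<partial>?M)))\<^sup>2"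
    by (simp add: ennreal_power)
  also have "\<dots> \<le> (\<integral>\<^sup>+x. ennreal (norm (f x * g x)) \<partial>?M)\<^sup>2"
    by (intro power_mono integral_norm_bound_ennreal L2_mult_integrable assms) auto
  also have "(\<integral>\<^sup>+x. ennreal (norm (f x * g x)) \<partial>?M) = (\<integral>\<^sup>+x. ennreal \<bar>f x\<bar> * ennreal \<bar>g x\<bar> \<partial>?M)"
    by (simp add: abs_mult ennreal_mult')
  also have "\<dots>\<^sup>2 \<le> (\<integral>\<^sup>+x. (ennreal \<bar>f x\<bar>)\<^sup>2 \<partial>?M) * (\<integral>\<^sup>+x. (ennreal \<bar>g x\<bar>)\<^sup>2 \<partial>?M)"
    by (rule Cauchy_Schwarz_nn_integral) auto
  also have "\<dots> = ennreal ((\<integral>x. (f x)\<^sup>2 \<partial>?M) * (\<integral>x. (g x)\<^sup>2 \<partial>?M))"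
    by (simp add: sq assms ennreal_mult')
  finally show ?thesis by (subst (asm) ennreal_le_iff) auto
qed

text \<open>By Cauchy-Schwarz it suffices that one factor vanishes in the L2 norm while the other
  stays bounded; boundedness is supplied as convergence of the squared norms, so that a fixed factor
  is the constant case.\<close>

lemma tendsto_integral_mult_0:
  fixes s t :: "nat \<Rightarrow> real^'d \<Rightarrow> real"
  assumes L2: "\<And>m. s m \<in> L2 \<Omega>" "\<And>m. t m \<in> L2 \<Omega>"
    and s: "(\<lambda>m. \<integral>x. (s m x)\<^sup>2 \<partial>lebesgue_on \<Omega>) \<longlonglongrightarrow> 0"
    and t: "(\<lambda>m. \<integral>x. (t m x)\<^sup>2 \<partial>lebesgue_on \<Omega>) \<longlonglongrightarrow> c"
  shows "(\<lambda>m. \<integral>x. s m x * t m x \<partial>lebesgue_on \<Omega>) \<longlonglongrightarrow> 0"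
proof -
  have "(\<lambda>m. (\<integral>x. s m x * t m x \<partial>lebesgue_on \<Omega>)\<^sup>2) \<longlonglongrightarrow> 0"
  proof (rule tendsto_sandwich[OF _ _ tendsto_const])
    show "(\<lambda>m. (\<integral>x. (s m x)\<^sup>2 \<partial>lebesgue_on \<Omega>) * (\<integral>x. (t m x)\<^sup>2 \<partial>lebesgue_on \<Omega>)) \<longlonglongrightarrow> 0"
      using tendsto_mult[OF s t] by simp
  qed (auto simp: L2_Cauchy_Schwarz L2)
  then show ?thesis by (simp add: tendsto_null_power[of _ _ 2] flip: power2_eq_square)
qed

text \<open>Expanding ab = (a - a')(b - b') + (a - a')b' + (b - b')a' + a'b' leaves a factor tending
  to 0 in L2 in every term but the last.\<close>

lemma tendsto_integral_mult:
  fixes a b :: "nat \<Rightarrow> real^'d \<Rightarrow> real"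
  assumes L2: "\<And>m. a m \<in> L2 \<Omega>" "\<And>m. b m \<in> L2 \<Omega>" "a' \<in> L2 \<Omega>" "b' \<in> L2 \<Omega>"
    and a: "(\<lambda>m. \<integral>x. (a m x - a' x)\<^sup>2 \<partial>lebesgue_on \<Omega>) \<longlonglongrightarrow> 0"
    and b: "(\<lambda>m. \<integral>x. (b m x - b' x)\<^sup>2 \<partial>lebesgue_on \<Omega>) \<longlonglongrightarrow> 0"
  shows "(\<lambda>m. \<integral>x. a m x * b m x \<partial>lebesgue_on \<Omega>) \<longlonglongrightarrow> (\<integral>x. a' x * b' x \<partial>lebesgue_on \<Omega>)"
proof -
  let ?M = "lebesgue_on \<Omega>"
  note i = L2_mult_integrable L2_diff L2
  have 1: "(\<lambda>m. \<integral>x. (a m x - a' x) * (b m x - b' x) \<partial>?M) \<longlonglongrightarrow> 0"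
    by (rule tendsto_integral_mult_0[OF _ _ a b]) (intro i)+
  have 2: "(\<lambda>m. \<integral>x. (a m x - a' x) * b' x \<partial>?M) \<longlonglongrightarrow> 0"
    by (rule tendsto_integral_mult_0[OF _ _ a tendsto_const]) (intro i)+
  have 3: "(\<lambda>m. \<integral>x. (b m x - b' x) * a' x \<partial>?M) \<longlonglongrightarrow> 0"
    by (rule tendsto_integral_mult_0[OF _ _ b tendsto_const]) (intro i)+
  have "(\<integral>x. a m x * b m x \<partial>?M) = (\<integral>x. (a m x - a' x) * (b m x - b' x) \<partial>?M)
      + (\<integral>x. (a m x - a' x) * b' x \<partial>?M) + (\<integral>x. (b m x - b' x) * a' x \<partial>?M) + (\<integral>x. a' x * b' x \<partial>?M)" for m
  proof -
    have "(\<integral>x. a m x * b m x \<partial>?M) = (\<integral>x. (a m x - a' x) * (b m x - b' x)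
      + (a m x - a' x) * b' x + (b m x - b' x) * a' x + a' x * b' x \<partial>?M)"
      by (intro Bochner_Integration.integral_cong) (auto simp: algebra_simps)
    then show ?thesis by (simp only: Bochner_Integration.integral_add Bochner_Integration.integrable_add i)
  qed
  then show ?thesis
    using tendsto_add[OF tendsto_add[OF tendsto_add[OF 1 2] 3] tendsto_const[of "\<integral>x. a' x * b' x \<partial>?M"]]
    by simp
qed

lemma L2_sum:
  assumes "finite I" "\<And>i. i \<in> I \<Longrightarrow> f i \<in> L2 \<Omega>"
  shows "(\<lambda>x. \<Sum>i\<in>I. f i x) \<in> L2 \<Omega>"
  using assms
proof (induction I rule: finite_induct)
  case empty
  then show ?case by (simp add: L2_def)
qed (auto intro: L2_add)

text \<open>A vector field is the finite sum of its components, each re-embedded by the linear map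
  \<open>axis i\<close>. As the entries may themselves be vectors, two applications handle matrix
  fields.\<close>

lemma L2_vecI:
  fixes f :: "real^'d \<Rightarrow> 'b::euclidean_space^'n"
  assumes "\<And>i. (\<lambda>x. f x $ i) \<in> L2 \<Omega>"
  shows "f \<in> L2 \<Omega>"
proof -
  have "bounded_linear (axis i :: 'b \<Rightarrow> 'b^'n)" for i
    by (intro linear_conv_bounded_linear[THEN iffD1] linearI) (auto simp: axis_def vec_eq_iff)
  then have "(\<lambda>x. \<Sum>i\<in>UNIV. axis i (f x $ i)) \<in> L2 \<Omega>"
    by (intro L2_sum L2_bounded_linear[where h = "axis _"] assms) auto
  also have "(\<lambda>x. \<Sum>i\<in>UNIV. axis i (f x $ i)) = f"
    by (auto simp: fun_eq_iff vec_eq_iff axis_def if_distrib if_distribR sum.If_cases)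
  finally show ?thesis .
qed

lemma L2_integral_norm_add_le:
  assumes "f \<in> L2 \<Omega>" "g \<in> L2 \<Omega>"
  shows "(\<integral>x. (norm (f x + g x))\<^sup>2 \<partial>lebesgue_on \<Omega>)
    \<le> 2 * (\<integral>x. (norm (f x))\<^sup>2 \<partial>lebesgue_on \<Omega>) + 2 * (\<integral>x. (norm (g x))\<^sup>2 \<partial>lebesgue_on \<Omega>)"
proof -
  have "(\<integral>x. (norm (f x + g x))\<^sup>2 \<partial>lebesgue_on \<Omega>)
      \<le> (\<integral>x. 2 * (norm (f x))\<^sup>2 + 2 * (norm (g x))\<^sup>2 \<partial>lebesgue_on \<Omega>)"
    using assms L2_add[OF assms] by (intro integral_mono norm_add_square_le) (auto simp: L2_def)
  also have "\<dots> = 2 * (\<integral>x. (norm (f x))\<^sup>2 \<partial>lebesgue_on \<Omega>) + 2 * (\<integral>x. (norm (g x))\<^sup>2 \<partial>lebesgue_on \<Omega>)"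
    using assms by (subst Bochner_Integration.integral_add) (auto simp: L2_def)
  finally show ?thesis .
qed

text \<open>Fourth powers are expressed as squares of squares, so the L2 lemmas apply to
  \<open>f\<close> squared directly. Measurability of \<open>f\<close> is stated separately because
  that of its square does not imply it.\<close>

definition L4 :: "(real^'d::finite) set \<Rightarrow> (real^'d \<Rightarrow> real) set" where
  "L4 \<Omega> = {f. f \<in> borel_measurable (lebesgue_on \<Omega>) \<and> (\<lambda>x. (f x)\<^sup>2) \<in> L2 \<Omega>}"

lemma L4_square: "f \<in> L4 \<Omega> \<Longrightarrow> (\<lambda>x. (f x)\<^sup>2) \<in> L2 \<Omega>"
  by (simp add: L4_def)

lemma L4_mult: "f \<in> L4 \<Omega> \<Longrightarrow> g \<in> L4 \<Omega> \<Longrightarrow> (\<lambda>x. f x * g x) \<in> L2 \<Omega>"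
  using L2_mult_integrable[OF L4_square L4_square, of f \<Omega> g]
  by (auto simp: L2_real_iff L4_def power_mult_distrib)

lemma L4_diff:
  assumes f: "f \<in> L4 \<Omega>" and g: "g \<in> L4 \<Omega>" shows "(\<lambda>x. f x - g x) \<in> L4 \<Omega>"
proof -
  have "(\<lambda>x. ((f x)\<^sup>2 - 2 *\<^sub>R (f x * g x)) + (g x)\<^sup>2) \<in> L2 \<Omega>"
    by (intro L2_add L2_diff L2_scaleR L4_mult L4_square f g)
  also have "(\<lambda>x. ((f x)\<^sup>2 - 2 *\<^sub>R (f x * g x)) + (g x)\<^sup>2) = (\<lambda>x. (f x - g x)\<^sup>2)"
    by (simp add: power2_diff fun_eq_iff)
  finally show ?thesis using f g by (auto simp: L4_def)
qed

text \<open>The difference of the products has the three-term expansion used for L2 limits. Its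
  square is at most three times the sum of the squared terms, and each of these is a product of two
  squares in L2, one of which tends to 0.\<close>

lemma tendsto_L2_mult:
  fixes a b :: "nat \<Rightarrow> real^'d \<Rightarrow> real"
  assumes L4: "\<And>m. a m \<in> L4 \<Omega>" "\<And>m. b m \<in> L4 \<Omega>" "a' \<in> L4 \<Omega>" "b' \<in> L4 \<Omega>"
    and a: "(\<lambda>m. \<integral>x. ((a m x - a' x)\<^sup>2)\<^sup>2 \<partial>lebesgue_on \<Omega>) \<longlonglongrightarrow> 0"
    and b: "(\<lambda>m. \<integral>x. ((b m x - b' x)\<^sup>2)\<^sup>2 \<partial>lebesgue_on \<Omega>) \<longlonglongrightarrow> 0"
  shows "(\<lambda>m. \<integral>x. (a m x * b m x - a' x * b' x)\<^sup>2 \<partial>lebesgue_on \<Omega>) \<longlonglongrightarrow> 0"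
proof -
  let ?M = "lebesgue_on \<Omega>"
  note i = L2_mult_integrable L4_square L4_diff L4
  have 1: "(\<lambda>m. \<integral>x. (a m x - a' x)\<^sup>2 * (b m x - b' x)\<^sup>2 \<partial>?M) \<longlonglongrightarrow> 0"
    by (rule tendsto_integral_mult_0[OF _ _ a b]) (intro i)+
  have 2: "(\<lambda>m. \<integral>x. (a m x - a' x)\<^sup>2 * (b' x)\<^sup>2 \<partial>?M) \<longlonglongrightarrow> 0"
    by (rule tendsto_integral_mult_0[OF _ _ a tendsto_const]) (intro i)+
  have 3: "(\<lambda>m. \<integral>x. (b m x - b' x)\<^sup>2 * (a' x)\<^sup>2 \<partial>?M) \<longlonglongrightarrow> 0"
    by (rule tendsto_integral_mult_0[OF _ _ b tendsto_const]) (intro i)+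
  let ?R = "\<lambda>m x. (a m x - a' x)\<^sup>2 * (b m x - b' x)\<^sup>2 + (a m x - a' x)\<^sup>2 * (b' x)\<^sup>2 + (b m x - b' x)\<^sup>2 * (a' x)\<^sup>2"
  have R: "integrable ?M (?R m)" for m
    by (intro Bochner_Integration.integrable_add i)
  have le: "(\<integral>x. (a m x * b m x - a' x * b' x)\<^sup>2 \<partial>?M) \<le> (\<integral>x. 3 * ?R m x \<partial>?M)" for m
  proof (rule integral_mono)
    show "integrable ?M (\<lambda>x. (a m x * b m x - a' x * b' x)\<^sup>2)"
      using L2_diff[OF L4_mult[OF L4(1,2)] L4_mult[OF L4(3,4)]] by (simp add: L2_real_iff)
    have le: "(p + q + r)\<^sup>2 \<le> 3 * (p\<^sup>2 + q\<^sup>2 + r\<^sup>2)" for p q r :: real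
      using sum_squares_bound[of p q] sum_squares_bound[of p r] sum_squares_bound[of q r]
      by (simp add: power2_eq_square algebra_simps)
    show "(a m x * b m x - a' x * b' x)\<^sup>2 \<le> 3 * ?R m x" for x
    proof -
      have "a m x * b m x - a' x * b' x
          = (a m x - a' x) * (b m x - b' x) + (a m x - a' x) * b' x + (b m x - b' x) * a' x"
        by (simp add: algebra_simps)
      then show ?thesis
        using le[of "(a m x - a' x) * (b m x - b' x)" "(a m x - a' x) * b' x" "(b m x - b' x) * a' x"]
        by (simp only: power_mult_distrib)
    qed
  qed (intro integrable_mult_right R)
  have lim: "(\<lambda>m. \<integral>x. 3 * ?R m x \<partial>?M) \<longlonglongrightarrow> 0"
  proof -
    have "(\<integral>x. ?R m x \<partial>?M) = (\<integral>x. (a m x - a' x)\<^sup>2 * (b m x - b' x)\<^sup>2 \<partial>?M)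
      + (\<integral>x. (a m x - a' x)\<^sup>2 * (b' x)\<^sup>2 \<partial>?M) + (\<integral>x. (b m x - b' x)\<^sup>2 * (a' x)\<^sup>2 \<partial>?M)" for m
      by (simp only: Bochner_Integration.integral_add Bochner_Integration.integrable_add i)
    then show ?thesis
      using tendsto_mult_left[OF tendsto_add[OF tendsto_add[OF 1 2] 3], of 3]
      by (simp only: integral_mult_right_zero mult_zero_right add_0_right)
  qed
  show ?thesis
    by (rule tendsto_sandwich[OF _ _ tendsto_const lim]) (simp_all only: le eventually_True, simp)
qed

section \<open>Functions in \<open>H\<^sup>1\<^sub>0\<close> and the convective form\<close>

lemma test_fun_L2:
  fixes f :: "real^'d \<Rightarrow> real"
  assumes "open \<Omega>" "test_fun \<Omega> f" shows "f \<in> L2 \<Omega>"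
  using assms test_fun_integrable(1)[OF assms(1) test_fun_mult[OF assms(2,2)]]
    test_fun_integrable(1)[OF assms]
  by (simp add: L2_real_iff power2_eq_square borel_measurable_integrable)

lemma test_fun_L4:
  fixes f :: "real^'d \<Rightarrow> real"
  assumes "open \<Omega>" "test_fun \<Omega> f" shows "f \<in> L4 \<Omega>"
  using L2_measurable[OF test_fun_L2[OF assms]] test_fun_L2[OF assms(1) test_fun_mult[OF assms(2,2)]]
  by (simp add: L4_def power2_eq_square)

text \<open>All integrals of test functions are finite, so the whole-space bound becomes a real
  number computed on \<open>\<Omega>\<close>. The left side remains an extended integral because
  Fatou's lemma will be applied to it.\<close>

lemma ladyzhenskaya:
  fixes f :: "real^'d \<Rightarrow> real"
  assumes dim: "CARD('d) = 2 \<or> CARD('d) = 3" and \<Omega>: "open \<Omega>" and f: "test_fun \<Omega> f"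
  shows "(\<integral>\<^sup>+x. ennreal (((f x)\<^sup>2)\<^sup>2) \<partial>lebesgue_on \<Omega>) \<le> ennreal (8 *
    ((\<integral>x. (f x)\<^sup>2 \<partial>lebesgue_on \<Omega>) + (\<Sum>l\<in>UNIV. \<integral>x. (partial l f x)\<^sup>2 \<partial>lebesgue_on \<Omega>))\<^sup>2)"
proof -
  let ?M = "lebesgue_on \<Omega>"
  let ?E = "(\<integral>x. (f x)\<^sup>2 \<partial>?M) + (\<Sum>l\<in>UNIV. \<integral>x. (partial l f x)\<^sup>2 \<partial>?M)"
  note [measurable] = test_fun_borel[OF f] test_fun_borel[OF test_fun_partial[OF f]]
  have sq: "(\<integral>\<^sup>+x. (ennreal \<bar>g x\<bar>)\<^sup>2 \<partial>lborel) = ennreal (\<integral>x. (g x)\<^sup>2 \<partial>?M)" if g: "test_fun \<Omega> g" for g :: "real^'d \<Rightarrow> real"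
  proof -
    have "test_fun \<Omega> (\<lambda>x. (g x)\<^sup>2)" using test_fun_mult[OF g g] by (simp add: power2_eq_square)
    from nn_integral_eq_integral[OF test_fun_integrable(1)[OF \<Omega> this]] test_fun_integrable(2)[OF \<Omega> this]
    show ?thesis by (simp add: ennreal_power)
  qed
  have "test_fun \<Omega> (\<lambda>x. ((f x)\<^sup>2)\<^sup>2)"
    using test_fun_mult[OF test_fun_mult[OF f f] test_fun_mult[OF f f]] by (simp add: power2_eq_square)
  from test_fun_integrable(2)[OF \<Omega> this]
  have "(\<integral>\<^sup>+x. ennreal (((f x)\<^sup>2)\<^sup>2) \<partial>?M) = (\<integral>\<^sup>+x. (ennreal \<bar>f x\<bar>)^4 \<partial>lborel)"
    by (simp add: ennreal_power)
  also have "\<dots> \<le> 8 * (\<integral>\<^sup>+x. (ennreal \<bar>f x\<bar>)\<^sup>2 + (\<Sum>l\<in>UNIV. (ennreal \<bar>partial l f x\<bar>)\<^sup>2) \<partial>lborel)\<^sup>2"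
  proof (cases "CARD('d) = 2")
    case True
    then obtain i j :: 'd where "UNIV = {i, j}" "i \<noteq> j" by (auto simp: card_2_iff)
    then show ?thesis by (rule ladyzhenskaya_plane[OF f])
  next
    case False
    then obtain i j k :: 'd where "UNIV = {i, j, k}" "i \<noteq> j" "i \<noteq> k" "j \<noteq> k"
      using dim by (auto simp: card_3_iff)
    then show ?thesis by (rule ladyzhenskaya_space[OF f])
  qed
  also have "(\<integral>\<^sup>+x. (ennreal \<bar>f x\<bar>)\<^sup>2 + (\<Sum>l\<in>UNIV. (ennreal \<bar>partial l f x\<bar>)\<^sup>2) \<partial>lborel) = ennreal ?E"
    by (simp add: nn_integral_add nn_integral_sum sq f test_fun_partial sum_nonneg sum_ennreal flip: ennreal_plus)
  also have "8 * (ennreal ?E)\<^sup>2 = ennreal (8 * ?E\<^sup>2)"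
  proof -
    have "8 * (ennreal e)\<^sup>2 = ennreal (8 * e\<^sup>2)" if "0 \<le> e" for e
      using that by (simp add: ennreal_power ennreal_mult')
    moreover have "0 \<le> ?E" by (intro add_nonneg_nonneg sum_nonneg) simp_all
    ultimately show ?thesis by blast
  qed
  finally show ?thesis .
qed

text \<open>The density part of \<open>H10\<close> for a single scalar component. \<open>Z\<close>
  is recorded as the L2 limit of classical derivatives; integration by parts enters separately,
  through the weak gradient being tested.\<close>

definition H10_approx :: "(real^'d::finite) set \<Rightarrow> (nat \<Rightarrow> real^'d \<Rightarrow> real) \<Rightarrow> (real^'d \<Rightarrow> real) \<Rightarrow>
    ('d \<Rightarrow> real^'d \<Rightarrow> real) \<Rightarrow> bool" where
  "H10_approx \<Omega> \<phi> z Z \<longleftrightarrow> (\<forall>m. test_fun \<Omega> (\<phi> m)) \<and> z \<in> L2 \<Omega> \<and> (\<forall>l. Z l \<in> L2 \<Omega>)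
    \<and> (\<lambda>m. \<integral>x. (\<phi> m x - z x)\<^sup>2 \<partial>lebesgue_on \<Omega>) \<longlonglongrightarrow> 0
    \<and> (\<forall>l. (\<lambda>m. \<integral>x. (partial l (\<phi> m) x - Z l x)\<^sup>2 \<partial>lebesgue_on \<Omega>) \<longlonglongrightarrow> 0)"

lemma L2_dist_triangle:
  fixes f g h :: "real^'d \<Rightarrow> real"
  assumes "f \<in> L2 \<Omega>" "g \<in> L2 \<Omega>" "h \<in> L2 \<Omega>"
  shows "(\<integral>x. (f x - g x)\<^sup>2 \<partial>lebesgue_on \<Omega>)
    \<le> 2 * ((\<integral>x. (f x - h x)\<^sup>2 \<partial>lebesgue_on \<Omega>) + (\<integral>x. (g x - h x)\<^sup>2 \<partial>lebesgue_on \<Omega>))"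
proof -
  have i: "integrable (lebesgue_on \<Omega>) (\<lambda>x. (p x - q x)\<^sup>2)" if "p \<in> L2 \<Omega>" "q \<in> L2 \<Omega>" for p q :: "real^'d \<Rightarrow> real"
    using L2_diff[OF that] by (simp add: L2_real_iff)
  have le: "(a - b)\<^sup>2 \<le> 2 * ((a - c)\<^sup>2 + (b - c)\<^sup>2)" for a b c :: real
    using sum_squares_bound[of "a - c" "c - b"] by (simp add: power2_eq_square algebra_simps)
  have "(\<integral>x. (f x - g x)\<^sup>2 \<partial>lebesgue_on \<Omega>) \<le> (\<integral>x. 2 * ((f x - h x)\<^sup>2 + (g x - h x)\<^sup>2) \<partial>lebesgue_on \<Omega>)"
    by (intro integral_mono integrable_mult_right Bochner_Integration.integrable_add i assms le)
  then show ?thesis by (simp add: i assms)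
qed

text \<open>Ladyzhenskaya's inequality for differences of approximants shows that they are Cauchy in
  L4. Their limit is identified with \<open>z\<close> by Fatou's lemma, which bounds the
  fourth-power distance from \<open>\<phi> m\<close> to \<open>z\<close> by the H1 error
  \<open>e m\<close>; both claims follow from that single bound.\<close>

lemma H10_approx_L4:
  fixes z :: "real^'d \<Rightarrow> real"
  assumes dim: "CARD('d) = 2 \<or> CARD('d) = 3" and \<Omega>: "open \<Omega>" and ap: "H10_approx \<Omega> \<phi> z Z"
  shows "z \<in> L4 \<Omega>" "(\<lambda>m. \<integral>x. ((\<phi> m x - z x)\<^sup>2)\<^sup>2 \<partial>lebesgue_on \<Omega>) \<longlonglongrightarrow> 0"
proof -
  let ?M = "lebesgue_on \<Omega>"
  have \<phi>: "test_fun \<Omega> (\<phi> m)" and z: "z \<in> L2 \<Omega>" and Z: "Z l \<in> L2 \<Omega>" for m l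
    using ap by (auto simp: H10_approx_def)
  have \<phi>L2: "\<phi> m \<in> L2 \<Omega>" and p\<phi>L2: "partial l (\<phi> m) \<in> L2 \<Omega>" for m l
    using \<phi> test_fun_partial[OF \<phi>] test_fun_L2[OF \<Omega>] by auto
  note [measurable] = L2_measurable[OF z] L2_measurable[OF \<phi>L2]
  define e where "e m = (\<integral>x. (\<phi> m x - z x)\<^sup>2 \<partial>?M) + (\<Sum>l\<in>UNIV. \<integral>x. (partial l (\<phi> m) x - Z l x)\<^sup>2 \<partial>?M)" for m
  have e0: "e m \<ge> 0" for m unfolding e_def by (intro add_nonneg_nonneg sum_nonneg) auto
  have e: "e \<longlonglongrightarrow> 0"
    unfolding e_def using ap by (auto simp: H10_approx_def intro!: tendsto_add_zero tendsto_null_sum)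
  have bound: "(\<integral>\<^sup>+x. ennreal (((\<phi> m x - \<phi> n x)\<^sup>2)\<^sup>2) \<partial>?M) \<le> ennreal (8 * (2 * (e m + e n))\<^sup>2)" for m n
  proof -
    have "test_fun \<Omega> (\<lambda>x. \<phi> m x + - 1 * \<phi> n x)"
      by (intro test_fun_add \<phi> test_fun_bounded_linear[OF bounded_linear_mult_right])
    then have t: "test_fun \<Omega> (\<lambda>x. \<phi> m x - \<phi> n x)" by simp
    have p: "partial l (\<lambda>x. \<phi> m x - \<phi> n x) x = partial l (\<phi> m) x - partial l (\<phi> n) x" for l x
      using has_derivative_imp_partial[OF has_derivative_diff[OF
        test_fun_differentiable[OF \<phi>, unfolded frechet_derivative_works] test_fun_differentiable[OF \<phi>, unfolded frechet_derivative_works]]]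
      by (simp add: partial_def)
    have "(\<integral>x. (\<phi> m x - \<phi> n x)\<^sup>2 \<partial>?M) + (\<Sum>l\<in>UNIV. \<integral>x. (partial l (\<phi> m) x - partial l (\<phi> n) x)\<^sup>2 \<partial>?M)
       \<le> 2 * ((\<integral>x. (\<phi> m x - z x)\<^sup>2 \<partial>?M) + (\<integral>x. (\<phi> n x - z x)\<^sup>2 \<partial>?M))
         + (\<Sum>l\<in>UNIV. 2 * ((\<integral>x. (partial l (\<phi> m) x - Z l x)\<^sup>2 \<partial>?M) + (\<integral>x. (partial l (\<phi> n) x - Z l x)\<^sup>2 \<partial>?M)))"
      by (intro add_mono sum_mono L2_dist_triangle \<phi>L2 p\<phi>L2 z Z)
    also have "\<dots> = 2 * (e m + e n)"
      by (simp add: e_def sum.distrib algebra_simps flip: sum_distrib_left)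
    finally have "(\<integral>x. (\<phi> m x - \<phi> n x)\<^sup>2 \<partial>?M) + (\<Sum>l\<in>UNIV. \<integral>x. (partial l (\<phi> m) x - partial l (\<phi> n) x)\<^sup>2 \<partial>?M) \<le> 2 * (e m + e n)" .
    then have "8 * ((\<integral>x. (\<phi> m x - \<phi> n x)\<^sup>2 \<partial>?M) + (\<Sum>l\<in>UNIV. \<integral>x. (partial l (\<phi> m) x - partial l (\<phi> n) x)\<^sup>2 \<partial>?M))\<^sup>2
       \<le> 8 * (2 * (e m + e n))\<^sup>2"
      by (intro mult_left_mono power_mono add_nonneg_nonneg sum_nonneg) auto
    from order_trans[OF ladyzhenskaya[OF dim \<Omega> t, unfolded p] ennreal_leI[OF this]] show ?thesis .
  qed
  \<comment> \<open>L2 convergence gives pointwise convergence only along a subsequence. That is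
    enough for Fatou, since \<open>e\<close> still tends to 0 along \<open>r\<close> while
    \<open>m\<close> is held fixed.\<close>
  have "\<exists>r. strict_mono r \<and> (AE x in ?M. (\<lambda>n. (\<phi> (r n) x - z x)\<^sup>2) \<longlonglongrightarrow> 0)"
  proof (rule tendsto_L1_AE_subseq)
    show "integrable ?M (\<lambda>x. (\<phi> n x - z x)\<^sup>2)" for n
      using L2_diff[OF \<phi>L2 z] by (simp add: L2_real_iff)
    show "(\<lambda>n. \<integral>x. norm ((\<phi> n x - z x)\<^sup>2) \<partial>?M) \<longlonglongrightarrow> 0"
      using ap by (simp add: H10_approx_def)
  qed
  then obtain r where r: "strict_mono r" and lim: "AE x in ?M. (\<lambda>n. (\<phi> (r n) x - z x)\<^sup>2) \<longlonglongrightarrow> 0"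
    by blast
  have fatou: "(\<integral>\<^sup>+x. ennreal (((\<phi> m x - z x)\<^sup>2)\<^sup>2) \<partial>?M) \<le> ennreal (8 * (2 * e m)\<^sup>2)" for m
  proof -
    have "(\<integral>\<^sup>+x. ennreal (((\<phi> m x - z x)\<^sup>2)\<^sup>2) \<partial>?M)
        = (\<integral>\<^sup>+x. liminf (\<lambda>n. ennreal (((\<phi> m x - \<phi> (r n) x)\<^sup>2)\<^sup>2)) \<partial>?M)"
    proof (rule nn_integral_cong_AE, use lim in eventually_elim)
      case (elim x)
      then have "(\<lambda>n. \<phi> (r n) x - z x) \<longlonglongrightarrow> 0"
        by (simp add: tendsto_null_power[of _ _ 2])
      then have "(\<lambda>n. \<phi> (r n) x) \<longlonglongrightarrow> z x" by (simp add: LIM_zero_iff)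
      then have "(\<lambda>n. ennreal (((\<phi> m x - \<phi> (r n) x)\<^sup>2)\<^sup>2)) \<longlonglongrightarrow> ennreal (((\<phi> m x - z x)\<^sup>2)\<^sup>2)"
        by (intro tendsto_intros)
      from lim_imp_Liminf[OF sequentially_bot this] show ?case by (rule sym)
    qed
    also have "\<dots> \<le> liminf (\<lambda>n. \<integral>\<^sup>+x. ennreal (((\<phi> m x - \<phi> (r n) x)\<^sup>2)\<^sup>2) \<partial>?M)"
      by (rule nn_integral_liminf) measurable
    also have "\<dots> \<le> liminf (\<lambda>n. ennreal (8 * (2 * (e m + e (r n)))\<^sup>2))"
      by (intro Liminf_mono always_eventually allI bound)
    also have "\<dots> = ennreal (8 * (2 * (e m + 0))\<^sup>2)"
      by (intro lim_imp_Liminf tendsto_intros LIMSEQ_subseq_LIMSEQ[OF e r, unfolded comp_def]) auto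
    finally show ?thesis by simp
  qed
  have d: "(\<lambda>x. \<phi> m x - z x) \<in> L4 \<Omega>" for m
  proof -
    have "integrable ?M (\<lambda>x. ((\<phi> m x - z x)\<^sup>2)\<^sup>2)"
      by (rule integrableI_bounded) (use fatou[of m] in \<open>auto intro: le_less_trans\<close>)
    then show ?thesis by (simp add: L4_def L2_real_iff)
  qed
  \<comment> \<open>Here \<open>z\<close> is written as \<open>\<phi> 0\<close> minus the difference
    \<open>\<phi> 0 - z\<close>.\<close>
  from L4_diff[OF test_fun_L4[OF \<Omega> \<phi>[of 0]] d[of 0]] show "z \<in> L4 \<Omega>" by simp
  show "(\<lambda>m. \<integral>x. ((\<phi> m x - z x)\<^sup>2)\<^sup>2 \<partial>?M) \<longlonglongrightarrow> 0"
  proof (rule tendsto_sandwich[OF _ _ tendsto_const])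
    have "(\<lambda>m. 8 * (2 * e m)\<^sup>2) \<longlonglongrightarrow> 8 * (2 * 0)\<^sup>2" by (intro tendsto_intros e)
    then show "(\<lambda>m. 8 * (2 * e m)\<^sup>2) \<longlonglongrightarrow> 0" by simp
    have "(\<integral>x. ((\<phi> m x - z x)\<^sup>2)\<^sup>2 \<partial>?M) \<le> 8 * (2 * e m)\<^sup>2" for m
      using fatou[of m] d[of m]
      by (subst (asm) nn_integral_eq_integral) (auto simp: L4_def L2_real_iff)
    then show "\<forall>\<^sub>F m in sequentially. (\<integral>x. ((\<phi> m x - z x)\<^sup>2)\<^sup>2 \<partial>?M) \<le> 8 * (2 * e m)\<^sup>2" by simp
  qed simp
qed

text \<open>Products of approximants are test functions, so every weak derivative of \<open>v\<close> can be tested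
  against them; in the limit the Leibniz rule appears.\<close>

lemma weak_derivative_product:
  fixes v w z g :: "real^'d \<Rightarrow> real"
  assumes dim: "CARD('d) = 2 \<or> CARD('d) = 3" and \<Omega>: "open \<Omega>"
    and w: "H10_approx \<Omega> \<omega> w W" and z: "H10_approx \<Omega> \<zeta> z Z"
    and v: "v \<in> L4 \<Omega>" and g: "g \<in> L2 \<Omega>"
    and weak: "\<And>\<phi>. test_fun \<Omega> \<phi> \<Longrightarrow>
      (\<integral>x. v x * partial l \<phi> x \<partial>lebesgue_on \<Omega>) = - (\<integral>x. g x * \<phi> x \<partial>lebesgue_on \<Omega>)"
  shows "(\<integral>x. g x * (w x * z x) \<partial>lebesgue_on \<Omega>)
    = - ((\<integral>x. (v x * w x) * Z l x \<partial>lebesgue_on \<Omega>) + (\<integral>x. (v x * z x) * W l x \<partial>lebesgue_on \<Omega>))"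
proof -
  let ?M = "lebesgue_on \<Omega>"
  have t: "test_fun \<Omega> (\<omega> m)" "test_fun \<Omega> (\<zeta> m)" for m
    using w z by (auto simp: H10_approx_def)
  note L4 = test_fun_L4[OF \<Omega> t(1)] test_fun_L4[OF \<Omega> t(2)] H10_approx_L4[OF dim \<Omega> w] H10_approx_L4[OF dim \<Omega> z]
  have L2: "partial l (\<omega> m) \<in> L2 \<Omega>" "partial l (\<zeta> m) \<in> L2 \<Omega>" "W l \<in> L2 \<Omega>" "Z l \<in> L2 \<Omega>" for m
    using w z test_fun_L2[OF \<Omega> test_fun_partial] by (auto simp: H10_approx_def)
  have dW: "(\<lambda>m. \<integral>x. (partial l (\<omega> m) x - W l x)\<^sup>2 \<partial>?M) \<longlonglongrightarrow> 0"
    and dZ: "(\<lambda>m. \<integral>x. (partial l (\<zeta> m) x - Z l x)\<^sup>2 \<partial>?M) \<longlonglongrightarrow> 0"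
    using w z by (auto simp: H10_approx_def)
  have const: "(\<lambda>m. \<integral>x. ((v x - v x)\<^sup>2)\<^sup>2 \<partial>?M) \<longlonglongrightarrow> 0" "(\<lambda>m. \<integral>x. (g x - g x)\<^sup>2 \<partial>?M) \<longlonglongrightarrow> 0"
    by simp_all
  \<comment> \<open>As \<open>g\<close> is only in L2, the product of the two approximants must
    itself converge in L2; L4 convergence of both factors delivers this. The fixed functions
    \<open>g\<close> and \<open>v\<close> enter as constant sequences.\<close>
  have 1: "(\<lambda>m. \<integral>x. g x * (\<omega> m x * \<zeta> m x) \<partial>?M) \<longlonglongrightarrow> (\<integral>x. g x * (w x * z x) \<partial>?M)"
    by (rule tendsto_integral_mult[OF g L4_mult[OF L4(1,2)] g L4_mult[OF L4(3,5)] const(2)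
        tendsto_L2_mult[OF L4(1,2,3,5,4,6)]])
  have 2: "(\<lambda>m. \<integral>x. (v x * \<omega> m x) * partial l (\<zeta> m) x \<partial>?M) \<longlonglongrightarrow> (\<integral>x. (v x * w x) * Z l x \<partial>?M)"
    by (rule tendsto_integral_mult[OF L4_mult[OF v L4(1)] L2(2) L4_mult[OF v L4(3)] L2(4)
        tendsto_L2_mult[OF v L4(1) v L4(3) const(1) L4(4)] dZ])
  have 3: "(\<lambda>m. \<integral>x. (v x * \<zeta> m x) * partial l (\<omega> m) x \<partial>?M) \<longlonglongrightarrow> (\<integral>x. (v x * z x) * W l x \<partial>?M)"
    by (rule tendsto_integral_mult[OF L4_mult[OF v L4(2)] L2(1) L4_mult[OF v L4(5)] L2(3)
        tendsto_L2_mult[OF v L4(2) v L4(5) const(1) L4(6)] dW])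
  have "(\<integral>x. g x * (\<omega> m x * \<zeta> m x) \<partial>?M) = - ((\<integral>x. (v x * \<omega> m x) * partial l (\<zeta> m) x \<partial>?M)
      + (\<integral>x. (v x * \<zeta> m x) * partial l (\<omega> m) x \<partial>?M))" for m
  proof -
    have "- (\<integral>x. g x * (\<omega> m x * \<zeta> m x) \<partial>?M) = (\<integral>x. v x * partial l (\<lambda>x. \<omega> m x * \<zeta> m x) x \<partial>?M)"
      using weak[OF test_fun_mult[OF t]] by simp
    also have "\<dots> = (\<integral>x. (v x * \<omega> m x) * partial l (\<zeta> m) x + (v x * \<zeta> m x) * partial l (\<omega> m) x \<partial>?M)"
      by (simp add: partial_mult test_fun_differentiable[OF t(1)] test_fun_differentiable[OF t(2)] algebra_simps)
    also have "\<dots> = (\<integral>x. (v x * \<omega> m x) * partial l (\<zeta> m) x \<partial>?M) + (\<integral>x. (v x * \<zeta> m x) * partial l (\<omega> m) x \<partial>?M)"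
      by (intro Bochner_Integration.integral_add L2_mult_integrable L4_mult v L4 L2)
    finally show ?thesis by simp
  qed
  with 1 have "(\<lambda>m. - ((\<integral>x. (v x * \<omega> m x) * partial l (\<zeta> m) x \<partial>?M)
      + (\<integral>x. (v x * \<zeta> m x) * partial l (\<omega> m) x \<partial>?M))) \<longlonglongrightarrow> (\<integral>x. g x * (w x * z x) \<partial>?M)" by simp
  from LIMSEQ_unique[OF this tendsto_minus[OF tendsto_add[OF 2 3]]] show ?thesis .
qed

section \<open>Vector fields: components and the linear structure of \<open>H10\<close>\<close>

lemma test_fun_nth: "test_fun \<Omega> f \<Longrightarrow> test_fun \<Omega> (\<lambda>x. f x $ i)"
  by (rule test_fun_bounded_linear[OF bounded_linear_vec_nth])

lemma cgrad_nth:
  assumes "test_fun \<Omega> \<phi>"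
  shows "cgrad \<phi> x $ i $ j = partial j (\<lambda>x. \<phi> x $ i) x"
  using partial_bounded_linear[OF bounded_linear_vec_nth test_fun_differentiable[OF assms]]
  by (simp add: cgrad_def)

lemma test_fun_vec_L2:
  fixes \<phi> :: "real^'d \<Rightarrow> real^'d"
  assumes "open \<Omega>" "test_fun \<Omega> \<phi>"
  shows "\<phi> \<in> L2 \<Omega>" "cgrad \<phi> \<in> L2 \<Omega>"
proof -
  show "\<phi> \<in> L2 \<Omega>"
    by (intro L2_vecI test_fun_L2 assms test_fun_nth)
  show "cgrad \<phi> \<in> L2 \<Omega>"
    by (intro L2_vecI) (simp add: cgrad_nth[OF assms(2)] test_fun_L2[OF assms(1)] test_fun_partial test_fun_nth assms(2))
qed

lemma cgrad_add:
  assumes "test_fun \<Omega> \<phi>" "test_fun \<Omega> \<psi>"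
  shows "cgrad (\<lambda>x. \<phi> x + \<psi> x) x = cgrad \<phi> x + cgrad \<psi> x"
  by (simp add: cgrad_def vec_eq_iff partial_add test_fun_differentiable[OF assms(1)] test_fun_differentiable[OF assms(2)])

lemma cgrad_scaleR:
  assumes "test_fun \<Omega> \<phi>"
  shows "cgrad (\<lambda>x. c *\<^sub>R \<phi> x) x = c *\<^sub>R cgrad \<phi> x"
  by (simp add: cgrad_def vec_eq_iff
      partial_bounded_linear[OF bounded_linear_scaleR_right test_fun_differentiable[OF assms]])

lemma H10_scaleR:
  assumes "u \<in> H10 \<Omega>" shows "(\<lambda>x. c *\<^sub>R u x) \<in> H10 \<Omega>"
proof -
  let ?M = "lebesgue_on \<Omega>"
  obtain G \<phi> where G: "u \<in> L2 \<Omega>" "G \<in> L2 \<Omega>" "weak_grad \<Omega> u G" and t: "\<And>m. test_fun \<Omega> (\<phi> m)"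
    and lim: "(\<lambda>m. \<integral>x. (norm (\<phi> m x - u x))\<^sup>2 \<partial>?M) \<longlonglongrightarrow> 0"
      "(\<lambda>m. \<integral>x. (norm (cgrad (\<phi> m) x - G x))\<^sup>2 \<partial>?M) \<longlonglongrightarrow> 0"
    using assms unfolding H10_def by blast
  have sc: "(norm (c *\<^sub>R a - c *\<^sub>R b))\<^sup>2 = c\<^sup>2 * (norm (a - b))\<^sup>2" for a b :: "'b::real_normed_vector"
    by (simp add: power_mult_distrib flip: scaleR_diff_right)
  have "weak_grad \<Omega> (\<lambda>x. c *\<^sub>R u x) (\<lambda>x. c *\<^sub>R G x)"
    using G(3) by (simp add: weak_grad_def mult.assoc)
  moreover have "(\<lambda>m. \<integral>x. (norm (c *\<^sub>R \<phi> m x - c *\<^sub>R u x))\<^sup>2 \<partial>?M) \<longlonglongrightarrow> 0"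
    using tendsto_mult_left[OF lim(1), of "c\<^sup>2"] by (simp add: sc)
  moreover have "(\<lambda>m. \<integral>x. (norm (cgrad (\<lambda>x. c *\<^sub>R \<phi> m x) x - c *\<^sub>R G x))\<^sup>2 \<partial>?M) \<longlonglongrightarrow> 0"
    using tendsto_mult_left[OF lim(2), of "c\<^sup>2"] by (simp add: sc cgrad_scaleR[OF t])
  ultimately show ?thesis
    unfolding H10_def mem_Collect_eq
    by (intro conjI L2_scaleR G exI[of _ "\<lambda>x. c *\<^sub>R G x"] exI[of _ "\<lambda>m x. c *\<^sub>R \<phi> m x"] allI
        test_fun_bounded_linear[OF bounded_linear_scaleR_right] t)
qed

text \<open>Approximants and gradient witnesses add. Together with scaling this admits both the
  extrapolated velocity and the combination used as test field. Openness of \<open>\<Omega>\<close>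
  makes test functions square-integrable on it, which justifies splitting the integrals.\<close>

lemma H10_add:
  assumes \<Omega>: "open \<Omega>" and u: "u \<in> H10 \<Omega>" and v: "v \<in> H10 \<Omega>"
  shows "(\<lambda>x. u x + v x) \<in> H10 \<Omega>"
proof -
  let ?M = "lebesgue_on \<Omega>"
  obtain G \<phi> where G: "u \<in> L2 \<Omega>" "G \<in> L2 \<Omega>" "weak_grad \<Omega> u G" and \<phi>: "\<And>m. test_fun \<Omega> (\<phi> m)"
    and lim\<phi>: "(\<lambda>m. \<integral>x. (norm (\<phi> m x - u x))\<^sup>2 \<partial>?M) \<longlonglongrightarrow> 0"
      "(\<lambda>m. \<integral>x. (norm (cgrad (\<phi> m) x - G x))\<^sup>2 \<partial>?M) \<longlonglongrightarrow> 0"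
    using u unfolding H10_def by blast
  obtain H \<psi> where H: "v \<in> L2 \<Omega>" "H \<in> L2 \<Omega>" "weak_grad \<Omega> v H" and \<psi>: "\<And>m. test_fun \<Omega> (\<psi> m)"
    and lim\<psi>: "(\<lambda>m. \<integral>x. (norm (\<psi> m x - v x))\<^sup>2 \<partial>?M) \<longlonglongrightarrow> 0"
      "(\<lambda>m. \<integral>x. (norm (cgrad (\<psi> m) x - H x))\<^sup>2 \<partial>?M) \<longlonglongrightarrow> 0"
    using v unfolding H10_def by blast
  have lim: "(\<lambda>m. \<integral>x. (norm ((a m x + b m x) - (a' x + b' x)))\<^sup>2 \<partial>?M) \<longlonglongrightarrow> 0"
    if L2: "\<And>m. a m \<in> L2 \<Omega>" "\<And>m. b m \<in> L2 \<Omega>" "a' \<in> L2 \<Omega>" "b' \<in> L2 \<Omega>"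
      and a: "(\<lambda>m. \<integral>x. (norm (a m x - a' x))\<^sup>2 \<partial>?M) \<longlonglongrightarrow> 0"
      and b: "(\<lambda>m. \<integral>x. (norm (b m x - b' x))\<^sup>2 \<partial>?M) \<longlonglongrightarrow> 0"
    for a b :: "nat \<Rightarrow> real^'a \<Rightarrow> 'b::euclidean_space" and a' b'
  proof (rule tendsto_sandwich[OF _ _ tendsto_const])
    show "(\<lambda>m. 2 * (\<integral>x. (norm (a m x - a' x))\<^sup>2 \<partial>?M) + 2 * (\<integral>x. (norm (b m x - b' x))\<^sup>2 \<partial>?M)) \<longlonglongrightarrow> 0"
      using tendsto_add[OF tendsto_mult_left[OF a, of 2] tendsto_mult_left[OF b, of 2]] by simp
    have "(\<integral>x. (norm ((a m x + b m x) - (a' x + b' x)))\<^sup>2 \<partial>?M)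
      \<le> 2 * (\<integral>x. (norm (a m x - a' x))\<^sup>2 \<partial>?M) + 2 * (\<integral>x. (norm (b m x - b' x))\<^sup>2 \<partial>?M)" for m
      using L2_integral_norm_add_le[OF L2_diff[OF L2(1,3)] L2_diff[OF L2(2,4)], of m m]
      by (simp add: add_diff_add)
    then show "\<forall>\<^sub>F m in sequentially. (\<integral>x. (norm ((a m x + b m x) - (a' x + b' x)))\<^sup>2 \<partial>?M)
      \<le> 2 * (\<integral>x. (norm (a m x - a' x))\<^sup>2 \<partial>?M) + 2 * (\<integral>x. (norm (b m x - b' x))\<^sup>2 \<partial>?M)" by simp
  qed simp
  have "weak_grad \<Omega> (\<lambda>x. u x + v x) (\<lambda>x. G x + H x)"
    unfolding weak_grad_def
  proof (intro allI impI)
    fix \<eta> :: "real^'a \<Rightarrow> real" and i j assume \<eta>: "test_fun \<Omega> \<eta>"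
    note i = L2_mult_integrable[OF L2_nth[OF G(1)]] L2_mult_integrable[OF L2_nth[OF H(1)]]
      L2_mult_integrable[OF L2_nth[OF L2_nth[OF G(2)]]] L2_mult_integrable[OF L2_nth[OF L2_nth[OF H(2)]]]
      test_fun_L2[OF \<Omega>] \<eta> test_fun_partial
    have "(\<integral>x. (u x + v x) $ i * partial j \<eta> x \<partial>?M)
        = (\<integral>x. u x $ i * partial j \<eta> x \<partial>?M) + (\<integral>x. v x $ i * partial j \<eta> x \<partial>?M)"
      by (subst Bochner_Integration.integral_add[symmetric]) (auto intro!: i simp: distrib_right)
    also have "\<dots> = - ((\<integral>x. G x $ i $ j * \<eta> x \<partial>?M) + (\<integral>x. H x $ i $ j * \<eta> x \<partial>?M))"
      using G(3) H(3) \<eta> by (simp add: weak_grad_def)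
    also have "\<dots> = - (\<integral>x. (G x + H x) $ i $ j * \<eta> x \<partial>?M)"
      by (subst Bochner_Integration.integral_add[symmetric]) (auto intro!: i simp: distrib_right)
    finally show "(\<integral>x. (u x + v x) $ i * partial j \<eta> x \<partial>?M) = - (\<integral>x. (G x + H x) $ i $ j * \<eta> x \<partial>?M)" .
  qed
  moreover have "(\<lambda>m. \<integral>x. (norm ((\<phi> m x + \<psi> m x) - (u x + v x)))\<^sup>2 \<partial>?M) \<longlonglongrightarrow> 0"
    by (intro lim test_fun_vec_L2(1)[OF \<Omega>] \<phi> \<psi> G H lim\<phi> lim\<psi>)
  moreover have "(\<lambda>m. \<integral>x. (norm (cgrad (\<lambda>x. \<phi> m x + \<psi> m x) x - (G x + H x)))\<^sup>2 \<partial>?M) \<longlonglongrightarrow> 0"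
    unfolding cgrad_add[OF \<phi> \<psi>]
    by (intro lim test_fun_vec_L2(2)[OF \<Omega>] \<phi> \<psi> G H lim\<phi> lim\<psi>)
  ultimately show ?thesis
    unfolding H10_def mem_Collect_eq
    by (intro conjI L2_add G H exI[of _ "\<lambda>x. G x + H x"] exI[of _ "\<lambda>m x. \<phi> m x + \<psi> m x"] allI
        test_fun_add \<phi> \<psi>)
qed

lemma H10_diff: "open \<Omega> \<Longrightarrow> u \<in> H10 \<Omega> \<Longrightarrow> v \<in> H10 \<Omega> \<Longrightarrow> (\<lambda>x. u x - v x) \<in> H10 \<Omega>"
  using H10_add[of \<Omega> u "\<lambda>x. (-1) *\<^sub>R v x"] H10_scaleR[of v \<Omega> "-1"] by simp

section \<open>The chosen weak gradient and the skew symmetry of convection\<close>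

lemma wgrad_H10:
  assumes "u \<in> H10 \<Omega>"
  shows "wgrad \<Omega> u \<in> L2 \<Omega>" "weak_grad \<Omega> u (wgrad \<Omega> u)"
proof -
  have "\<exists>G. G \<in> L2 \<Omega> \<and> weak_grad \<Omega> u G" using assms by (auto simp: H10_def)
  from someI_ex[OF this] show "wgrad \<Omega> u \<in> L2 \<Omega>" "weak_grad \<Omega> u (wgrad \<Omega> u)"
    by (simp_all add: wgrad_def)
qed

lemma wdiv_L2: "u \<in> H10 \<Omega> \<Longrightarrow> wdiv \<Omega> u \<in> L2 \<Omega>"
  unfolding wdiv_def[abs_def] by (intro L2_sum L2_nth wgrad_H10) auto

text \<open>Functions that agree almost everywhere have the same set of weak gradients, and
  \<open>wgrad\<close> applies the choice operator to that set. The chosen representatives are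
  therefore identical, not just equal almost everywhere.\<close>

lemma wgrad_cong_AE:
  assumes \<Omega>: "open \<Omega>" and L2: "u \<in> L2 \<Omega>" "v \<in> L2 \<Omega>" and eq: "AE x in lebesgue_on \<Omega>. u x = v x"
  shows "wgrad \<Omega> u = wgrad \<Omega> v"
proof -
  have "(\<integral>x. u x $ i * partial j \<phi> x \<partial>lebesgue_on \<Omega>) = (\<integral>x. v x $ i * partial j \<phi> x \<partial>lebesgue_on \<Omega>)"
    if \<phi>: "test_fun \<Omega> \<phi>" for \<phi> :: "real^'a \<Rightarrow> real" and i j
  proof -
    have [measurable]: "partial j \<phi> \<in> borel_measurable (lebesgue_on \<Omega>)"
      "(\<lambda>x. u x $ i) \<in> borel_measurable (lebesgue_on \<Omega>)" "(\<lambda>x. v x $ i) \<in> borel_measurable (lebesgue_on \<Omega>)"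
      by (intro L2_measurable L2_nth L2 test_fun_L2[OF \<Omega>] test_fun_partial \<phi>)+
    show ?thesis by (rule integral_cong_AE) (use eq in auto)
  qed
  then have "weak_grad \<Omega> u = weak_grad \<Omega> v" by (auto simp: weak_grad_def fun_eq_iff)
  then show ?thesis by (simp add: wgrad_def)
qed

text \<open>The gradient \<open>G\<close> obtained here is the witness from \<open>H10\<close>, the
  one to which the gradients of the approximants are known to converge; \<open>wgrad\<close> may be
  another representative.\<close>

lemma H10_components:
  assumes \<Omega>: "open \<Omega>" and u: "u \<in> H10 \<Omega>"
  obtains \<phi> G where "G \<in> L2 \<Omega>" "weak_grad \<Omega> u G"
    "\<And>i. H10_approx \<Omega> (\<lambda>m x. \<phi> m x $ i) (\<lambda>x. u x $ i) (\<lambda>l x. G x $ i $ l)"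
proof -
  let ?M = "lebesgue_on \<Omega>"
  obtain G \<phi> where G: "u \<in> L2 \<Omega>" "G \<in> L2 \<Omega>" "weak_grad \<Omega> u G" and \<phi>: "\<And>m. test_fun \<Omega> (\<phi> m)"
    and lim: "(\<lambda>m. \<integral>x. (norm (\<phi> m x - u x))\<^sup>2 \<partial>?M) \<longlonglongrightarrow> 0"
      "(\<lambda>m. \<integral>x. (norm (cgrad (\<phi> m) x - G x))\<^sup>2 \<partial>?M) \<longlonglongrightarrow> 0"
    using u unfolding H10_def by blast
  have comp: "(\<lambda>m. \<integral>x. (norm (a m x $ i - a' x $ i))\<^sup>2 \<partial>?M) \<longlonglongrightarrow> 0"
    if L2: "\<And>m. a m \<in> L2 \<Omega>" "a' \<in> L2 \<Omega>" and a: "(\<lambda>m. \<integral>x. (norm (a m x - a' x))\<^sup>2 \<partial>?M) \<longlonglongrightarrow> 0"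
    for a :: "nat \<Rightarrow> real^'a \<Rightarrow> 'b::euclidean_space^'c" and a' i
  proof (rule tendsto_sandwich[OF _ _ tendsto_const a])
    have "(\<integral>x. (norm (a m x $ i - a' x $ i))\<^sup>2 \<partial>?M) \<le> (\<integral>x. (norm (a m x - a' x))\<^sup>2 \<partial>?M)" for m
    proof (rule integral_mono)
      show "integrable ?M (\<lambda>x. (norm (a m x - a' x))\<^sup>2)"
        using L2_diff[OF L2] by (simp add: L2_def)
      show "integrable ?M (\<lambda>x. (norm (a m x $ i - a' x $ i))\<^sup>2)"
        using L2_diff[OF L2_nth[OF L2(1)] L2_nth[OF L2(2)]] by (simp add: L2_def)
      show "(norm (a m x $ i - a' x $ i))\<^sup>2 \<le> (norm (a m x - a' x))\<^sup>2" for x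
        using Finite_Cartesian_Product.norm_nth_le[of "a m x - a' x" i] by (intro power_mono) auto
    qed
    then show "\<forall>\<^sub>F m in sequentially. (\<integral>x. (norm (a m x $ i - a' x $ i))\<^sup>2 \<partial>?M) \<le> (\<integral>x. (norm (a m x - a' x))\<^sup>2 \<partial>?M)"
      by simp
  qed simp
  have "H10_approx \<Omega> (\<lambda>m x. \<phi> m x $ i) (\<lambda>x. u x $ i) (\<lambda>l x. G x $ i $ l)" for i
    unfolding H10_approx_def
  proof (intro conjI allI test_fun_nth \<phi> L2_nth G)
    show "(\<lambda>m. \<integral>x. (\<phi> m x $ i - u x $ i)\<^sup>2 \<partial>?M) \<longlonglongrightarrow> 0"
      using comp[OF test_fun_vec_L2(1)[OF \<Omega> \<phi>] G(1) lim(1), of i] by simp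
    \<comment> \<open>Passing to components twice leads from the matrix to row \<open>i\<close> and
      then to entry \<open>l\<close>.\<close>
    show "(\<lambda>m. \<integral>x. (partial l (\<lambda>x. \<phi> m x $ i) x - G x $ i $ l)\<^sup>2 \<partial>?M) \<longlonglongrightarrow> 0" for l
      using comp[OF L2_nth[OF test_fun_vec_L2(2)[OF \<Omega> \<phi>]] L2_nth[OF G(2)]
          comp[OF test_fun_vec_L2(2)[OF \<Omega> \<phi>] G(2) lim(2)], of i l] by (simp add: cgrad_nth[OF \<phi>])
  qed
  with that G show ?thesis by blast
qed

text \<open>Let T be the integral \<open>?T\<close>. The Leibniz rule for component \<open>j\<close>
  of \<open>w\<close> against the square of component \<open>i\<close> of \<open>z\<close> gives -2T
  for the divergence integral with every square-integrable weak gradient of \<open>w\<close>, hence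
  both for the witness \<open>W\<close> and for \<open>wgrad\<close>. The rule for component
  \<open>i\<close> of \<open>z\<close> gives -(T - 2T) = T for the first integral, which cancels
  half of -2T.\<close>

lemma convective_component_zero:
  fixes w z :: "real^'d \<Rightarrow> real^'d"
  assumes dim: "CARD('d) = 2 \<or> CARD('d) = 3" and \<Omega>: "open \<Omega>" and w: "w \<in> H10 \<Omega>" and z: "z \<in> H10 \<Omega>"
  shows "(\<integral>x. wgrad \<Omega> z x $ i $ j * (w x $ j * z x $ i) \<partial>lebesgue_on \<Omega>)
    + (1/2) * (\<integral>x. wgrad \<Omega> w x $ j $ j * (z x $ i * z x $ i) \<partial>lebesgue_on \<Omega>) = 0"
proof -
  let ?M = "lebesgue_on \<Omega>"
  obtain \<omega> W where W: "W \<in> L2 \<Omega>" "weak_grad \<Omega> w W"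
    and \<omega>: "\<And>i. H10_approx \<Omega> (\<lambda>m x. \<omega> m x $ i) (\<lambda>x. w x $ i) (\<lambda>l x. W x $ i $ l)"
    using H10_components[OF \<Omega> w] by blast
  obtain \<zeta> Z where Z: "Z \<in> L2 \<Omega>" "weak_grad \<Omega> z Z"
    and \<zeta>: "\<And>i. H10_approx \<Omega> (\<lambda>m x. \<zeta> m x $ i) (\<lambda>x. z x $ i) (\<lambda>l x. Z x $ i $ l)"
    using H10_components[OF \<Omega> z] by blast
  let ?T = "\<integral>x. (z x $ i * w x $ j) * Z x $ i $ j \<partial>?M"
  have div: "(\<integral>x. H x $ j $ j * (z x $ i * z x $ i) \<partial>?M) = - 2 * ?T"
    if "H \<in> L2 \<Omega>" "weak_grad \<Omega> w H" for H
    using weak_derivative_product[OF dim \<Omega> \<zeta>[of i] \<zeta>[of i] H10_approx_L4(1)[OF dim \<Omega> \<omega>[of j]]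
        L2_nth[OF L2_nth[OF that(1)]], of j j j] that(2)
    by (simp add: weak_grad_def mult.commute)
  have "(\<integral>x. wgrad \<Omega> z x $ i $ j * (w x $ j * z x $ i) \<partial>?M)
      = - (?T + (\<integral>x. (z x $ i * z x $ i) * W x $ j $ j \<partial>?M))"
    using weak_derivative_product[OF dim \<Omega> \<omega>[of j] \<zeta>[of i] H10_approx_L4(1)[OF dim \<Omega> \<zeta>[of i]]
        L2_nth[OF L2_nth[OF wgrad_H10(1)[OF z]]], of j i j] wgrad_H10(2)[OF z]
    by (simp add: weak_grad_def)
  with div[OF W] div[OF wgrad_H10[OF w]] show ?thesis by (simp add: mult.commute)
qed

text \<open>Both integrals expand into double sums over \<open>i\<close> and \<open>j\<close> that
  cancel entry by entry. The expansion is legitimate since every term pairs a gradient entry in L2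
  with a product of two L4 functions.\<close>

lemma conv_form_self_zero:
  fixes w z :: "real^'d \<Rightarrow> real^'d"
  assumes dim: "CARD('d) = 2 \<or> CARD('d) = 3" and \<Omega>: "open \<Omega>" and w: "w \<in> H10 \<Omega>" and z: "z \<in> H10 \<Omega>"
  shows "conv_form \<Omega> w z z = 0"
proof -
  let ?M = "lebesgue_on \<Omega>"
  have L4: "(\<lambda>x. u x $ i) \<in> L4 \<Omega>" if "u \<in> H10 \<Omega>" for u i
    using H10_components[OF \<Omega> that] H10_approx_L4(1)[OF dim \<Omega>] by metis
  have 1: "(\<integral>x. (wgrad \<Omega> z x *v w x) \<bullet> z x \<partial>?M)
      = (\<Sum>i\<in>UNIV. \<Sum>j\<in>UNIV. \<integral>x. wgrad \<Omega> z x $ i $ j * (w x $ j * z x $ i) \<partial>?M)"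
    by (simp add: inner_vec_def matrix_vector_mult_def sum_distrib_right mult.assoc
        L2_mult_integrable L4_mult L4 w z L2_nth wgrad_H10)
  have 2: "(\<integral>x. wdiv \<Omega> w x * (z x \<bullet> z x) \<partial>?M)
      = (\<Sum>i\<in>UNIV. \<Sum>j\<in>UNIV. \<integral>x. wgrad \<Omega> w x $ j $ j * (z x $ i * z x $ i) \<partial>?M)"
    by (simp add: inner_vec_def wdiv_def sum_distrib_right sum_distrib_left
        L2_mult_integrable L4_mult L4 w z L2_nth wgrad_H10)
  show ?thesis
    unfolding conv_form_def 1 2
    using convective_component_zero[OF dim \<Omega> w z]
    by (simp add: sum_distrib_left flip: sum.distrib)
qed

section \<open>The energy equality\<close>

text \<open>With \<open>a\<close>, \<open>b\<close>, \<open>c\<close> the new, current and old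
  velocities, the first factor is 3/2 a - 2b + 1/2 c, the numerator of the BDF2 difference, and the
  second is the test field, that is a plus half the second difference. The energy is the G-norm of
  BDF2; the last term is its numerical dissipation.\<close>

lemma bdf2_energy_identity:
  fixes a b c :: "'a::real_inner"
  shows "((3/2) *\<^sub>R a - b + (1/2) *\<^sub>R c - b) \<bullet> ((3/2) *\<^sub>R a - b + (1/2) *\<^sub>R c)
    = (1/4) * ((norm a)\<^sup>2 + (norm (2 *\<^sub>R a - b))\<^sup>2 + (norm (a - b))\<^sup>2)
      - (1/4) * ((norm b)\<^sup>2 + (norm (2 *\<^sub>R b - c))\<^sup>2 + (norm (b - c))\<^sup>2)
      + (3/4) * (norm (a - 2 *\<^sub>R b + c))\<^sup>2"
  by (simp add: power2_norm_eq_inner inner_diff_left inner_diff_right inner_add_left inner_add_right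
      inner_commute[of b a] inner_commute[of c a] inner_commute[of c b] algebra_simps)

text \<open>For A = \<open>sqrt e * p\<close> and B = \<open>sqrt d * q\<close> this is (A - B)A =
  (A^2 - B^2 + (A - B)^2)/2. The geometric mean of the two parameters is what turns the mixed term
  into AB, so the identity is exact even when they vary.\<close>

lemma pressure_energy_identity:
  fixes e d p q :: real
  assumes "e \<ge> 0" "d \<ge> 0"
  shows "(e * p - sqrt (e * d) * q) * p
    = (1/2) * (e * p\<^sup>2) - (1/2) * (d * q\<^sup>2) + (1/2) * (sqrt e * p - sqrt d * q)\<^sup>2"
proof -
  obtain a b where "a \<ge> 0" "b \<ge> 0" "e = a\<^sup>2" "d = b\<^sup>2"
    using assms by (metis real_sqrt_ge_zero real_sqrt_pow2)
  then show ?thesis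
    by (simp add: real_sqrt_mult) (simp add: power2_eq_square field_simps)
qed

theorem theorem3p2:
  fixes \<Omega> :: "(real^'d) set"
    and \<nu> k :: real
    and \<epsilon> :: "nat \<Rightarrow> real"
    and f :: "nat \<Rightarrow> (real^'d \<Rightarrow> real^'d) \<Rightarrow> real"
    and u u1 :: "nat \<Rightarrow> real^'d \<Rightarrow> real^'d"
    and p :: "nat \<Rightarrow> real^'d \<Rightarrow> real"
    and N :: nat
  assumes dim: "CARD('d) = 2 \<or> CARD('d) = 3"
    and dom: "open \<Omega>" "bounded \<Omega>" "connected \<Omega>" "\<Omega> \<noteq> {}"
    and nu: "\<nu> > 0" and kpos: "k > 0"
    and eps: "\<And>n. \<epsilon> n > 0"
    and forcing: "\<And>n. f n \<in> Hm1 \<Omega>"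
    and reg_u: "\<And>n. u n \<in> H10 \<Omega>"
    and reg_u1: "\<And>n. u1 n \<in> H10 \<Omega>"
    and reg_p: "\<And>n. p n \<in> L2 \<Omega>"
    and momentum: "\<And>n v. n \<ge> 1 \<Longrightarrow> v \<in> H10 \<Omega> \<Longrightarrow>
          integral\<^sup>L (lebesgue_on \<Omega>) (\<lambda>x. ((1/k) *\<^sub>R (u1 (n+1) x - u n x)) \<bullet> v x)
        + conv_form \<Omega> (\<lambda>x. 2 *\<^sub>R u n x - u (n-1) x) (u1 (n+1)) v
        - integral\<^sup>L (lebesgue_on \<Omega>) (\<lambda>x. p (n+1) x * wdiv \<Omega> v x)
        + \<nu> * integral\<^sup>L (lebesgue_on \<Omega>) (\<lambda>x. wgrad \<Omega> (u1 (n+1)) x \<bullet> wgrad \<Omega> v x)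
        = f (n+1) v"
    and update: "\<And>n. n \<ge> 1 \<Longrightarrow> AE x in lebesgue_on \<Omega>.
          u (n+1) x = u1 (n+1) x - (1/3) *\<^sub>R (u1 (n+1) x - 2 *\<^sub>R u n x + u (n-1) x)"
    and continuity: "\<And>n q. n \<ge> 1 \<Longrightarrow> q \<in> L2 \<Omega> \<Longrightarrow>
          integral\<^sup>L (lebesgue_on \<Omega>)
            (\<lambda>x. ((\<epsilon> (n+1) * p (n+1) x - sqrt (\<epsilon> (n+1) * \<epsilon> n) * p n x) / k
                   + wdiv \<Omega> (u1 (n+1)) x) * q x) = 0"
    and N: "N > 1"
  shows "(1/4) * integral\<^sup>L (lebesgue_on \<Omega>) (\<lambda>x. (norm (u (N+1) x))\<^sup>2
              + (norm (2 *\<^sub>R u (N+1) x - u N x))\<^sup>2 + (norm (u (N+1) x - u N x))\<^sup>2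
              + 2 * \<epsilon> (N+1) * (p (N+1) x)\<^sup>2)
         + (\<Sum>n=1..N. integral\<^sup>L (lebesgue_on \<Omega>) (\<lambda>x.
              (3/4) * (norm (u (n+1) x - 2 *\<^sub>R u n x + u (n-1) x))\<^sup>2
              + (1/2) * (sqrt (\<epsilon> (n+1)) * p (n+1) x - sqrt (\<epsilon> n) * p n x)\<^sup>2))
         + (\<Sum>n=1..N. k * integral\<^sup>L (lebesgue_on \<Omega>) (\<lambda>x.
              \<nu> * (norm (wgrad \<Omega> (\<lambda>y. (3/2) *\<^sub>R u (n+1) y - u n y + (1/2) *\<^sub>R u (n-1) y) x))\<^sup>2))
       = (1/4) * integral\<^sup>L (lebesgue_on \<Omega>) (\<lambda>x. (norm (u 1 x))\<^sup>2
              + (norm (2 *\<^sub>R u 1 x - u 0 x))\<^sup>2 + (norm (u 1 x - u 0 x))\<^sup>2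
              + 2 * \<epsilon> 1 * (p 1 x)\<^sup>2)
         + k * (\<Sum>n=1..N. f (n+1) (\<lambda>x. (3/2) *\<^sub>R u (n+1) x - u n x + (1/2) *\<^sub>R u (n-1) x))"
proof -
  let ?M = "lebesgue_on \<Omega>"
  \<comment> \<open>Subtraction is truncated on naturals, so \<open>E n\<close> is the intended
    energy from n = 1 on; \<open>E 1\<close> involves \<open>u 0\<close>.\<close>
  define E where "E n = (1/4) * (\<integral>x. (norm (u n x))\<^sup>2 + (norm (2 *\<^sub>R u n x - u (n-1) x))\<^sup>2
      + (norm (u n x - u (n-1) x))\<^sup>2 + 2 * \<epsilon> n * (p n x)\<^sup>2 \<partial>?M)" for n
  define D where "D n = (\<integral>x. (3/4) * (norm (u (n+1) x - 2 *\<^sub>R u n x + u (n-1) x))\<^sup>2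
      + (1/2) * (sqrt (\<epsilon> (n+1)) * p (n+1) x - sqrt (\<epsilon> n) * p n x)\<^sup>2 \<partial>?M)" for n
  define v where "v n = (\<lambda>y. (3/2) *\<^sub>R u (n+1) y - u n y + (1/2) *\<^sub>R u (n-1) y)" for n
  define V where "V n = k * (\<integral>x. \<nu> * (norm (wgrad \<Omega> (v n) x))\<^sup>2 \<partial>?M)" for n
  note \<Omega> = dom(1)
  have uL2: "u n \<in> L2 \<Omega>" and u1L2: "u1 n \<in> L2 \<Omega>" for n
    using reg_u reg_u1 by (auto simp: H10_def)
  have sq: "integrable ?M (\<lambda>x. (norm (g x))\<^sup>2)" if "g \<in> L2 \<Omega>" for g :: "real^'d \<Rightarrow> 'b::euclidean_space"
    using that by (simp add: L2_def)
  have sqr: "integrable ?M (\<lambda>x. (g x)\<^sup>2)" if "g \<in> L2 \<Omega>" for g :: "real^'d \<Rightarrow> real"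
    using that by (simp add: L2_def)
  have pc: "(\<lambda>x. c * p n x) \<in> L2 \<Omega>" for c n
    using L2_scaleR[OF reg_p, of c n] by simp
  have step: "E (n+1) + D n + V n = E n + k * f (n+1) (v n)" if n: "n \<ge> 1" for n
  proof -
    have vH: "v n \<in> H10 \<Omega>"
      unfolding v_def by (intro H10_add H10_diff H10_scaleR \<Omega> reg_u)
    have vL2: "v n \<in> L2 \<Omega>" using vH by (simp add: H10_def)
    have ae: "AE x in ?M. v n x = u1 (n+1) x"
      using update[OF n]
    proof eventually_elim
      case (elim x)
      \<comment> \<open>The update in cleared form; solving it for \<open>u1 (n+1) x\<close> inverts
        the weight 2/3 and yields \<open>v n x\<close>.\<close>
      have "3 *\<^sub>R u (n+1) x = 2 *\<^sub>R u1 (n+1) x + 2 *\<^sub>R u n x - u (n-1) x"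
        unfolding elim by (simp add: vec_eq_iff field_simps)
      then show ?case by (simp add: v_def vec_eq_iff field_simps)
    qed
    \<comment> \<open>An equality of functions: the viscous term becomes a squared norm, and
      momentum and continuity contain the same divergence, so their pressure terms can
      cancel.\<close>
    have wg: "wgrad \<Omega> (u1 (n+1)) = wgrad \<Omega> (v n)"
      using wgrad_cong_AE[OF \<Omega> vL2 u1L2 ae] by simp
    have wd: "wdiv \<Omega> (u1 (n+1)) = wdiv \<Omega> (v n)"
      by (simp add: wdiv_def fun_eq_iff wg[simplified])
    note [measurable] = L2_measurable[OF vL2] L2_measurable[OF u1L2] L2_measurable[OF uL2]
      L2_measurable[OF wdiv_L2]
    have time: "(\<integral>x. ((1/k) *\<^sub>R (u1 (n+1) x - u n x)) \<bullet> v n x \<partial>?M)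
        = (1/k) * (\<integral>x. (v n x - u n x) \<bullet> v n x \<partial>?M)"
    proof -
      have "(\<integral>x. ((1/k) *\<^sub>R (u1 (n+1) x - u n x)) \<bullet> v n x \<partial>?M)
          = (\<integral>x. (1/k) * ((v n x - u n x) \<bullet> v n x) \<partial>?M)"
      proof (rule integral_cong_AE)
        show "AE x in ?M. ((1/k) *\<^sub>R (u1 (n+1) x - u n x)) \<bullet> v n x = (1/k) * ((v n x - u n x) \<bullet> v n x)"
          using ae by eventually_elim simp
      qed measurable
      then show ?thesis by simp
    qed
    have conv: "conv_form \<Omega> (\<lambda>x. 2 *\<^sub>R u n x - u (n-1) x) (u1 (n+1)) (v n) = 0"
    proof -
      let ?w = "\<lambda>x. 2 *\<^sub>R u n x - u (n-1) x"
      have wH: "?w \<in> H10 \<Omega>" by (intro H10_diff H10_scaleR \<Omega> reg_u)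
      have [measurable]: "wdiv \<Omega> ?w \<in> borel_measurable ?M" by (rule L2_measurable[OF wdiv_L2[OF wH]])
      \<comment> \<open>Only the divergence term contains \<open>u1 (n+1)\<close> itself. The
        gradient term sees it through \<open>wgrad\<close>, which has already been
        identified.\<close>
      have "(\<integral>x. wdiv \<Omega> ?w x * (u1 (n+1) x \<bullet> v n x) \<partial>?M) = (\<integral>x. wdiv \<Omega> ?w x * (v n x \<bullet> v n x) \<partial>?M)"
      proof (rule integral_cong_AE)
        show "AE x in ?M. wdiv \<Omega> ?w x * (u1 (n+1) x \<bullet> v n x) = wdiv \<Omega> ?w x * (v n x \<bullet> v n x)"
          using ae by eventually_elim simp
      qed measurable
      then have "conv_form \<Omega> ?w (u1 (n+1)) (v n) = conv_form \<Omega> ?w (v n) (v n)"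
        by (simp add: conv_form_def wg[simplified])
      then show ?thesis by (simp only: conv_form_self_zero[OF dim \<Omega> wH vH])
    qed
    let ?J = "\<integral>x. (\<epsilon> (n+1) * p (n+1) x - sqrt (\<epsilon> (n+1) * \<epsilon> n) * p n x) * p (n+1) x \<partial>?M"
    let ?P = "\<integral>x. p (n+1) x * wdiv \<Omega> (v n) x \<partial>?M"
    let ?I = "\<integral>x. (v n x - u n x) \<bullet> v n x \<partial>?M"
    have Jint: "integrable ?M (\<lambda>x. (\<epsilon> (n+1) * p (n+1) x - sqrt (\<epsilon> (n+1) * \<epsilon> n) * p n x) * p (n+1) x)"
      by (intro L2_mult_integrable L2_diff pc reg_p)
    have Iint: "integrable ?M (\<lambda>x. (v n x - u n x) \<bullet> v n x)"
      by (intro L2_inner_integrable L2_diff vL2 uL2)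
    \<comment> \<open>Continuity tested with \<open>p (n+1)\<close> expresses the pressure work
      \<open>?P\<close> in the momentum balance by the pressure difference
      \<open>?J\<close>.\<close>
    have P: "(1/k) * ?J + ?P = 0"
    proof -
      have "0 = (\<integral>x. (1/k) * ((\<epsilon> (n+1) * p (n+1) x - sqrt (\<epsilon> (n+1) * \<epsilon> n) * p n x) * p (n+1) x)
          + p (n+1) x * wdiv \<Omega> (v n) x \<partial>?M)"
        using continuity[OF n reg_p[of "n+1"]] by (simp add: wd[simplified] algebra_simps diff_divide_distrib)
      also have "\<dots> = (1/k) * ?J + ?P"
        by (subst Bochner_Integration.integral_add)
           (use Jint in \<open>auto intro!: L2_mult_integrable reg_p wdiv_L2 vH\<close>)
      finally show ?thesis by simp
    qed
    have V: "V n = k * (\<nu> * (\<integral>x. wgrad \<Omega> (v n) x \<bullet> wgrad \<Omega> (v n) x \<partial>?M))"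
      by (simp add: V_def power2_norm_eq_inner)
    have "(1/k) * ?I - ?P + \<nu> * (\<integral>x. wgrad \<Omega> (v n) x \<bullet> wgrad \<Omega> (v n) x \<partial>?M) = f (n+1) (v n)"
      using momentum[OF n vH] by (simp only: time conv wg add_0_right)
    with P have "(1/k) * (?I + ?J) + \<nu> * (\<integral>x. wgrad \<Omega> (v n) x \<bullet> wgrad \<Omega> (v n) x \<partial>?M) = f (n+1) (v n)"
      by (simp add: algebra_simps)
    then have "k * ((1/k) * (?I + ?J) + \<nu> * (\<integral>x. wgrad \<Omega> (v n) x \<bullet> wgrad \<Omega> (v n) x \<partial>?M)) = k * f (n+1) (v n)"
      by (rule arg_cong)
    then have IJ: "?I + ?J + V n = k * f (n+1) (v n)"
      using kpos unfolding V by (simp add: distrib_left)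
    have "?I + ?J = E (n+1) - E n + D n"
    proof -
      let ?e = "\<lambda>n x. (norm (u n x))\<^sup>2 + (norm (2 *\<^sub>R u n x - u (n-1) x))\<^sup>2
          + (norm (u n x - u (n-1) x))\<^sup>2 + 2 * \<epsilon> n * (p n x)\<^sup>2"
      let ?d = "\<lambda>x. (3/4) * (norm (u (n+1) x - 2 *\<^sub>R u n x + u (n-1) x))\<^sup>2
          + (1/2) * (sqrt (\<epsilon> (n+1)) * p (n+1) x - sqrt (\<epsilon> n) * p n x)\<^sup>2"
      have e: "integrable ?M (?e m)" for m
        by (intro Bochner_Integration.integrable_add integrable_mult_right sq sqr L2_diff L2_scaleR uL2 reg_p)
      have d: "integrable ?M ?d"
        by (intro Bochner_Integration.integrable_add integrable_mult_right sq sqr L2_add L2_diff L2_scaleR uL2 pc)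
      have "?I + ?J = (\<integral>x. (v n x - u n x) \<bullet> v n x
          + (\<epsilon> (n+1) * p (n+1) x - sqrt (\<epsilon> (n+1) * \<epsilon> n) * p n x) * p (n+1) x \<partial>?M)"
        by (rule Bochner_Integration.integral_add[symmetric, OF Iint Jint])
      \<comment> \<open>The two energy identities are added pointwise. The weight 2 on the squared
        pressure inside \<open>?e\<close> compensates the common factor 1/4, since the pressure
        identity carries 1/2.\<close>
      also have "\<dots> = (\<integral>x. (1/4) * ?e (n+1) x - (1/4) * ?e n x + ?d x \<partial>?M)"
      proof (rule Bochner_Integration.integral_cong[OF refl])
        fix x
        show "(v n x - u n x) \<bullet> v n x + (\<epsilon> (n+1) * p (n+1) x - sqrt (\<epsilon> (n+1) * \<epsilon> n) * p n x) * p (n+1) x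
            = (1/4) * ?e (n+1) x - (1/4) * ?e n x + ?d x"
          unfolding v_def bdf2_energy_identity
            pressure_energy_identity[OF less_imp_le[OF eps] less_imp_le[OF eps]] add_diff_cancel_right'
          by (simp only: algebra_simps)
      qed
      also have "\<dots> = (1/4) * (\<integral>x. ?e (n+1) x \<partial>?M) - (1/4) * (\<integral>x. ?e n x \<partial>?M) + (\<integral>x. ?d x \<partial>?M)"
        by (simp only: Bochner_Integration.integral_add Bochner_Integration.integral_diff
            Bochner_Integration.integrable_diff integrable_mult_right integral_mult_right_zero e d)
      finally show ?thesis by (simp only: E_def D_def)
    qed
    with IJ show ?thesis by linarith
  qed
  have "E (N+1) + (\<Sum>n=1..N. D n) + (\<Sum>n=1..N. V n) = E 1 + k * (\<Sum>n=1..N. f (n+1) (v n))"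
  \<comment> \<open>Telescoping begins at 0, where the sums are empty and both sides are
    \<open>E 1\<close>.\<close>
  proof (induction N)
    case (Suc N)
    then show ?case using step[of "Suc N"] by (simp add: distrib_left)
  qed simp
  then show ?thesis
    by (simp only: E_def D_def V_def v_def add_diff_cancel_right' diff_self_eq_0)
qed

end
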